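(* Suppose $u$ is a continuous complex-valued function on the closed quarter-plane $\mathbb{R}_{\ge0}\times\mathbb{R}_{\le0}$ which solves the Klein-Gordon equation $u''_{xy}+u=0$ in the sense of distribution theory in the interior quarter-plane $\mathbb{R}_{>0}\times\mathbb{R}_{<0}$. Suppose moreover that $u$ vanishes along the semi-axis $\{0\}\times\mathbb{R}_{\le0}$. Finally, assume that the nonempty subset $\mathcal{Y}\subset\mathbb{R}_{\le0}$ has $\inf\mathcal{Y}=-\infty$, and that $u$ enjoys the growth bound $$\forall y\in\mathcal{Y}:\quad |u(x,y)|=\mathrm{O}_y\big(\exp(\theta x^{q})\big)\quad\text{as } x\to+\infty,$$ where the implied constant is allowed to depend on $y$, and the parameters $q,\theta$ are confined to $0<q<\frac12$ and $0<\theta<+\infty$. It then follows that $u=0$ on $\mathbb{R}_{\ge0}\times\mathbb{R}_{\le0}$.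
   Context: Here $u''_{xy}=\partial_x\partial_y u$. The parameters $q$ and $\theta$ do not depend on $y$. *)

theory Defs
  imports "HOL-Analysis.Analysis" "HOL-Library.Landau_Symbols"
begin

text \<open>Real \<open>C\<^sup>k\<close> regularity on the whole space; the directions \<open>v\<close> range over all vectors,
  so for \<open>real \<times> real\<close> this covers all iterated partial derivatives.\<close>

primrec Ck :: "nat \<Rightarrow> ('a::real_normed_vector \<Rightarrow> 'b::real_normed_vector) \<Rightarrow> bool" where
  "Ck 0 f \<longleftrightarrow> continuous_on UNIV f"
| "Ck (Suc k) f \<longleftrightarrow> (\<forall>z. f differentiable (at z)) \<and>
     (\<forall>v. Ck k (\<lambda>z. frechet_derivative f (at z) v))"

definition smooth :: "('a::real_normed_vector \<Rightarrow> 'b::real_normed_vector) \<Rightarrow> bool" where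
  "smooth f \<longleftrightarrow> (\<forall>k. Ck k f)"

text \<open>The elements of \<open>C\<^sub>c\<^sup>\<infinity>(\<Omega>)\<close> are represented by their extensions by zero to the whole plane.\<close>

definition test_functions :: "(real \<times> real) set \<Rightarrow> (real \<times> real \<Rightarrow> complex) set" where
  "test_functions \<Omega> = {\<phi>. smooth \<phi> \<and> compact (closure {z. \<phi> z \<noteq> 0}) \<and> closure {z. \<phi> z \<noteq> 0} \<subseteq> \<Omega>}"

definition partial_x :: "(real \<times> real \<Rightarrow> complex) \<Rightarrow> real \<times> real \<Rightarrow> complex" where
  "partial_x \<phi> = (\<lambda>(x, y). vector_derivative (\<lambda>t. \<phi> (t, y)) (at x))"

definition partial_y :: "(real \<times> real \<Rightarrow> complex) \<Rightarrow> real \<times> real \<Rightarrow> complex" where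
  "partial_y \<phi> = (\<lambda>(x, y). vector_derivative (\<lambda>t. \<phi> (x, t)) (at y))"

text \<open>A functional on test functions is used as a plain function, of which only the values on
  \<open>test_functions \<Omega>\<close> matter. For \<open>u\<close> locally integrable on the open set \<open>\<Omega>\<close> (in particular for
  \<open>u\<close> continuous there), \<open>regular_distribution \<Omega> u\<close> is the distribution on \<open>\<Omega>\<close> given by \<open>u\<close>.\<close>

type_synonym functional = "(real \<times> real \<Rightarrow> complex) \<Rightarrow> complex"

definition regular_distribution :: "(real \<times> real) set \<Rightarrow> (real \<times> real \<Rightarrow> complex) \<Rightarrow> functional" where
  "regular_distribution \<Omega> u \<phi> = (LINT z:\<Omega>|lborel. u z * \<phi> z)"

definition distr_dx :: "functional \<Rightarrow> functional" where
  "distr_dx T \<phi> = - T (partial_x \<phi>)"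

definition distr_dy :: "functional \<Rightarrow> functional" where
  "distr_dy T \<phi> = - T (partial_y \<phi>)"

definition Klein_Gordon_distr :: "(real \<times> real) set \<Rightarrow> (real \<times> real \<Rightarrow> complex) \<Rightarrow> bool" where
  "Klein_Gordon_distr \<Omega> u \<longleftrightarrow>
     (\<forall>\<phi>\<in>test_functions \<Omega>.
        distr_dx (distr_dy (regular_distribution \<Omega> u)) \<phi> + regular_distribution \<Omega> u \<phi> = 0)"

end

theory Submission
  imports Defs "HOL-Complex_Analysis.Complex_Analysis" "HOL-Real_Asymp.Real_Asymp"
begin

text \<open>
  With \<open>v(x,t) = u(x,-t)\<close> and \<open>v(0,t) = 0\<close>, testing with products of one-variable test functions
  turns the equation into \<open>v(x,t) - v(x,s) = \<integral>\<^sub>0\<^sup>x \<integral>\<^sub>s\<^sup>t v\<close>. A weighted Gronwall estimate transports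
  subexponential growth in \<open>x\<close> from one time \<open>T \<in> -Y\<close> to all times in \<open>[0,T]\<close>, so the Laplace
  transforms in \<open>x\<close> exist for \<open>Re p > 0\<close> and \<open>F(p) = exp(-T/p) V\<^sub>T(p)\<close>, where \<open>F = V\<^sub>0\<close>. The growth bound gives
  \<open>|V\<^sub>T(p)| \<le> C\<^sub>T exp(c (Re p)\<^sup>-\<^sup>a)\<close> with \<open>a = q/(1-q) < 1\<close> and \<open>c\<close> independent of \<open>T\<close>.
  After the substitution \<open>1/p = s + s\<^sup>\<gamma>\<close> with \<open>\<gamma> < 1\<close> close to \<open>1\<close>, the second factor becomes
  \<open>exp(O(|s|\<^sup>b))\<close> with \<open>b < 1\<close> on \<open>Re s \<ge> 1\<close> and is removed by a factor \<open>exp(-D s\<^sup>b)\<close>; the product is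
  \<open>O(exp(-T Re s))\<close> for arbitrarily large \<open>T\<close>, hence zero by Phragmen--Lindeloef. So \<open>F = 0\<close>, whence
  \<open>v(x,0) = 0\<close> by injectivity of the Laplace transform, and \<open>v = 0\<close> by Gronwall again.
\<close>

section \<open>Smooth functions\<close>

text \<open>Vanishing on \<open>x = 0\<close> makes the equation an evolution in \<open>t\<close>
  generated by integration in \<open>x\<close>, a Volterra operator. It therefore runs backwards as
  well as forwards, and the Laplace transform in \<open>x\<close> turns its generator into
  multiplication by \<open>1/p\<close>. Two obstacles shape the last stage. The constant
  \<open>C_T\<close> is uncontrolled in \<open>T\<close>, so it may enter only as a qualitative
  bound, while the quantitative bound comes from one fixed time. Moreover, with
  \<open>z = 1/p\<close> one has \<open>Re p = Re z / |z|^2\<close>, so on a vertical line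
  \<open>(Re p)^(-a)\<close> grows like \<open>|z|^(2a)\<close>; for \<open>a >= 1/2\<close> no
  factor \<open>exp (- D z^b)\<close> with \<open>b < 1\<close> compensates this. Where
  \<open>Re z\<close> is at least of order \<open>|z|^g\<close>, the exponent drops to
  \<open>a (2 - g)\<close>, which tends to \<open>a\<close> as \<open>g\<close> tends to 1. So
  \<open>a < 1\<close> leaves room for an admissible \<open>g\<close>, and
  \<open>q / (1 - q) < 1\<close> is the condition \<open>q < 1/2\<close>. That \<theta> and
  \<open>q\<close> are common to all \<open>y\<close> makes one compensating factor serve all
  \<open>T\<close>.\<close>

lemma Ck_SucI:
  assumes "\<And>z. (f has_derivative f' z) (at z)" and "\<And>v. Ck k (\<lambda>z. f' z v)"
  shows "Ck (Suc k) f"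
proof -
  have "frechet_derivative f (at z) = f' z" for z
    using frechet_derivative_at[OF assms(1)] by simp
  with assms show ?thesis by (auto simp: differentiable_def)
qed

lemma Ck_SucD: "Ck (Suc k) f \<Longrightarrow> Ck k f"
proof (induction k arbitrary: f)
  case 0
  then show ?case
    by (auto intro!: differentiable_imp_continuous_on simp: differentiable_on_def)
next
  case (Suc k)
  then show ?case by simp
qed

lemma Ck_Suc_has_derivative:
  "Ck (Suc k) f \<Longrightarrow> (f has_derivative frechet_derivative f (at z)) (at z)"
  by (simp add: frechet_derivative_works)

lemma Ck_add: "Ck k f \<Longrightarrow> Ck k g \<Longrightarrow> Ck k (\<lambda>z. f z + g z)"
proof (induction k arbitrary: f g)
  case 0
  then show ?case by (simp add: continuous_on_add)
next
  case (Suc k)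
  show ?case
    by (rule Ck_SucI[OF has_derivative_add[OF Ck_Suc_has_derivative[OF Suc.prems(1)]
          Ck_Suc_has_derivative[OF Suc.prems(2)]]])
      (use Suc in auto)
qed

lemma Ck_bounded_linear: "bounded_linear L \<Longrightarrow> Ck k f \<Longrightarrow> Ck k (\<lambda>z. L (f z))"
proof (induction k arbitrary: f)
  case 0
  then show ?case by (simp add: bounded_linear.continuous_on)
next
  case (Suc k)
  show ?case
    by (rule Ck_SucI[OF bounded_linear.has_derivative[OF Suc.prems(1)
            Ck_Suc_has_derivative[OF Suc.prems(2)]]])
      (use Suc in auto)
qed

text \<open>The inner map has constant derivative \<open>L\<close>, so differentiating in direction
  \<open>v\<close> gives a function of the same form and the induction closes. Translations,
  reflections and coordinate projections are the cases that occur.\<close>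

lemma Ck_compose_affine: "bounded_linear L \<Longrightarrow> Ck k f \<Longrightarrow> Ck k (\<lambda>z. f (L z + c))"
proof (induction k arbitrary: f)
  case 0
  then have "continuous_on UNIV (\<lambda>z. L z + c)"
    by (intro continuous_on_add linear_continuous_on continuous_on_const)
  with 0 show ?case
    by (auto intro: continuous_on_compose2[of UNIV f])
next
  case (Suc k)
  have L: "((\<lambda>z. L z + c) has_derivative L) (at z)" for z
    using bounded_linear_imp_has_derivative[OF Suc.prems(1)] by (auto intro!: derivative_eq_intros)
  show ?case
    by (rule Ck_SucI[OF has_derivative_compose[OF L Ck_Suc_has_derivative[OF Suc.prems(2)]]])
      (use Suc in auto)
qed

lemma Ck_mult:
  fixes f g :: "'a::real_normed_vector \<Rightarrow> 'b::real_normed_algebra"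
  shows "Ck k f \<Longrightarrow> Ck k g \<Longrightarrow> Ck k (\<lambda>z. f z * g z)"
proof (induction k arbitrary: f g)
  case 0
  then show ?case by (simp add: continuous_on_mult)
next
  case (Suc k)
  show ?case
  proof (rule Ck_SucI[OF has_derivative_mult[OF Ck_Suc_has_derivative[OF Suc.prems(1)]
          Ck_Suc_has_derivative[OF Suc.prems(2)]]])
    fix v
    have "Ck k f" "Ck k g" "Ck k (\<lambda>z. frechet_derivative f (at z) v)"
      "Ck k (\<lambda>z. frechet_derivative g (at z) v)"
      using Suc.prems Ck_SucD[OF Suc.prems(1)] Ck_SucD[OF Suc.prems(2)] by simp_all
    then show "Ck k (\<lambda>z. f z * frechet_derivative g (at z) v + frechet_derivative f (at z) v * g z)"
      by (intro Ck_add Suc.IH)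
  qed
qed

lemma Ck_vector_derivativeI:
  assumes "\<And>x. (f has_vector_derivative f' x) (at x)" and "Ck k f'"
  shows "Ck (Suc k) f"
  using assms by (intro Ck_SucI[of f "\<lambda>x h. h *\<^sub>R f' x"])
    (auto simp: has_vector_derivative_def intro!: Ck_bounded_linear[OF bounded_linear_scaleR_right])

lemma smooth_add: "smooth f \<Longrightarrow> smooth g \<Longrightarrow> smooth (\<lambda>z. f z + g z)"
  by (simp add: smooth_def Ck_add)

lemma smooth_mult:
  fixes f g :: "'a::real_normed_vector \<Rightarrow> 'b::real_normed_algebra"
  shows "smooth f \<Longrightarrow> smooth g \<Longrightarrow> smooth (\<lambda>z. f z * g z)"
  by (simp add: smooth_def Ck_mult)

lemma smooth_bounded_linear: "bounded_linear L \<Longrightarrow> smooth f \<Longrightarrow> smooth (\<lambda>z. L (f z))"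
  by (simp add: smooth_def Ck_bounded_linear)

lemma smooth_compose_affine: "bounded_linear L \<Longrightarrow> smooth f \<Longrightarrow> smooth (\<lambda>z. f (L z + c))"
  by (simp add: smooth_def Ck_compose_affine)

lemma smooth_vector_derivativeI:
  assumes "\<And>x. (f has_vector_derivative f' x) (at x)" and "smooth f'"
  shows "smooth f"
  unfolding smooth_def
proof
  fix k show "Ck k f"
    using Ck_SucD[OF Ck_vector_derivativeI[OF assms(1)]] assms(2) by (simp add: smooth_def)
qed

lemma smooth_imp_continuous_on: "smooth f \<Longrightarrow> continuous_on S f"
  by (metis Ck.simps(1) continuous_on_subset smooth_def subset_UNIV)

lemma smooth_has_vector_derivative:
  fixes f :: "real \<Rightarrow> 'b::real_normed_vector"
  assumes "smooth f"
  shows "(f has_vector_derivative vector_derivative f (at x)) (at x)"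
proof -
  have "Ck (Suc 0) f" using assms by (simp only: smooth_def)
  then show ?thesis by (simp add: vector_derivative_works)
qed

lemma smooth_vector_derivative:
  fixes f :: "real \<Rightarrow> 'b::real_normed_vector"
  assumes "smooth f"
  shows "smooth (\<lambda>x. vector_derivative f (at x))"
  unfolding smooth_def
proof
  fix k
  have "Ck (Suc k) f" using assms by (simp only: smooth_def)
  then have "Ck k (\<lambda>z. frechet_derivative f (at z) 1)" and d: "\<And>z. f differentiable (at z)"
    by simp_all
  moreover have "frechet_derivative f (at z) 1 = vector_derivative f (at z)" for z
    using frechet_derivative_eq_vector_derivative[OF d] by simp
  ultimately show "Ck k (\<lambda>x. vector_derivative f (at x))" by simp
qed

text \<open>The function \<open>t^m exp (- t)\<close> at \<open>t = 1/x\<close>, extended by 0. The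
  index \<open>m\<close> makes the family closed under differentiation up to linear combinations;
  \<open>m = 0\<close> is the classical flat function.\<close>

definition exp_inv :: "nat \<Rightarrow> real \<Rightarrow> real" where
  "exp_inv m x = (if x > 0 then (1 / x) ^ m * exp (- (1 / x)) else 0)"

text \<open>A single term of the exponential series, that of index \<open>m + 2\<close>, is at most
  \<open>exp t\<close> for \<open>t = 1/x\<close>. The two extra powers of \<open>t\<close> leave
  second order in \<open>x\<close>, so the difference quotients at 0 tend to 0.\<close>

lemma exp_inv_bound: "\<bar>exp_inv m x\<bar> \<le> fact (m + 2) * x\<^sup>2"
proof (cases "x > 0")
  case True
  define t where "t = 1 / x"
  have t: "t > 0" using True by (simp add: t_def)
  have "summable (\<lambda>n. t ^ n /\<^sub>R fact n)"
    using summable_exp_generic[of t] by simp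
  then have "(\<Sum>n\<in>{m+2}. t ^ n /\<^sub>R fact n) \<le> exp t"
    unfolding exp_def using t by (intro sum_le_suminf) auto
  then have "t ^ (m + 2) \<le> exp t * fact (m + 2)"
    by (simp add: divide_le_eq field_simps del: fact_Suc power_Suc)
  then have "t ^ (m + 2) * exp (- t) \<le> fact (m + 2)"
    by (simp only: exp_minus) (simp add: field_simps del: fact_Suc power_Suc)
  then have "x\<^sup>2 * (t ^ (m + 2) * exp (- t)) \<le> x\<^sup>2 * fact (m + 2)"
    by (rule mult_left_mono) auto
  moreover have "x\<^sup>2 * t\<^sup>2 = 1"
    using True by (simp add: t_def power2_eq_square)
  then have "x\<^sup>2 * (t ^ (m + 2) * exp (- t)) = exp_inv m x"
    using True by (simp only: power_add exp_inv_def t_def[symmetric]) (simp add: algebra_simps)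
  moreover have "exp_inv m x \<ge> 0" by (simp add: exp_inv_def)
  ultimately show ?thesis by (simp only: abs_of_nonneg mult.commute)
qed (simp add: exp_inv_def)

lemma has_vector_derivative_exp_inv:
  "(exp_inv m has_vector_derivative exp_inv (m + 2) x - real m * exp_inv (m + 1) x) (at x)"
proof -
  consider "x > 0" | "x < 0" | "x = 0" by linarith
  then show ?thesis
  proof cases
    case 1
    define t where "t = 1 / x"
    have "((\<lambda>t. t ^ m * exp (- t)) has_field_derivative (m * t ^ (m - 1) - t ^ m) * exp (- t)) (at t)"
      by (auto intro!: derivative_eq_intros simp: algebra_simps)
    moreover have "((\<lambda>x. 1 / x) has_field_derivative - (t\<^sup>2)) (at x)"
      using 1 by (auto intro!: derivative_eq_intros simp: t_def power2_eq_square)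
    ultimately have "((\<lambda>x. (1 / x) ^ m * exp (- (1 / x))) has_field_derivative
        (m * t ^ (m - 1) - t ^ m) * exp (- t) * - (t\<^sup>2)) (at x)"
      unfolding t_def by (rule DERIV_chain2)
    moreover have "(m * t ^ (m - 1) - t ^ m) * exp (- t) * - (t\<^sup>2) =
        exp_inv (m + 2) x - real m * exp_inv (m + 1) x"
      using 1 unfolding exp_inv_def t_def[symmetric]
      by (cases m) (simp_all add: algebra_simps power2_eq_square)
    ultimately have "((\<lambda>x. (1 / x) ^ m * exp (- (1 / x))) has_field_derivative
        exp_inv (m + 2) x - real m * exp_inv (m + 1) x) (at x)"
      by simp
    then show ?thesis
      unfolding has_real_derivative_iff_has_vector_derivative
      by (rule has_vector_derivative_transform_within_open[where S = "{0<..}"])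
        (use 1 in \<open>auto simp: exp_inv_def\<close>)
  next
    case 2
    have "((\<lambda>x. 0) has_vector_derivative (0::real)) (at x)" by simp
    then have "(exp_inv m has_vector_derivative 0) (at x)"
      by (rule has_vector_derivative_transform_within_open[where S = "{..<0}"])
        (use 2 in \<open>auto simp: exp_inv_def\<close>)
    then show ?thesis using 2 by (simp add: exp_inv_def)
  next
    case 3
    have lim: "((\<lambda>y. exp_inv m y / y) \<longlongrightarrow> 0) (at 0)"
    proof (rule Lim_null_comparison)
      show "\<forall>\<^sub>F y in at 0. norm (exp_inv m y / y) \<le> fact (m + 2) * \<bar>y\<bar>"
      proof (rule always_eventually, rule allI)
        fix y
        show "norm (exp_inv m y / y) \<le> fact (m + 2) * \<bar>y\<bar>"
        proof (cases "y = 0")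
          case False
          have "\<bar>exp_inv m y\<bar> / \<bar>y\<bar> \<le> fact (m + 2) * y\<^sup>2 / \<bar>y\<bar>"
            by (intro divide_right_mono exp_inv_bound) simp
          also have "y\<^sup>2 = \<bar>y\<bar> * \<bar>y\<bar>" by (simp add: power2_eq_square)
          finally show ?thesis using False by (simp del: fact_Suc abs_mult_self_eq)
        qed simp
      qed
      show "((\<lambda>y. fact (m + 2) * \<bar>y\<bar>) \<longlongrightarrow> (0::real)) (at 0)"
        by (auto intro!: tendsto_eq_intros simp del: fact_Suc)
    qed
    then have "(exp_inv m has_field_derivative 0) (at 0)"
      by (simp add: DERIV_def exp_inv_def)
    then show ?thesis
      using 3 by (simp add: has_real_derivative_iff_has_vector_derivative exp_inv_def)
  qed
qed

lemma smooth_exp_inv: "smooth (exp_inv m)"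
  unfolding smooth_def
proof
  fix k show "Ck k (exp_inv m)"
  proof (induction k arbitrary: m)
    case 0
    have "(exp_inv m) differentiable (at x)" for x
      using has_vector_derivative_exp_inv differentiableI_vector by blast
    then show ?case
      by (simp add: differentiable_imp_continuous_within continuous_at_imp_continuous_on)
  next
    case (Suc k)
    have "Ck k (\<lambda>x. exp_inv (m + 2) x + (\<lambda>y. (- real m) * y) (exp_inv (m + 1) x))"
      by (rule Ck_add[OF Suc.IH Ck_bounded_linear[OF bounded_linear_mult_right Suc.IH]])
    then have "Ck k (\<lambda>x. exp_inv (m + 2) x - real m * exp_inv (m + 1) x)"
      by simp
    then show ?case
      by (rule Ck_vector_derivativeI[OF has_vector_derivative_exp_inv])
  qed
qed

definition bump :: "real \<Rightarrow> real \<Rightarrow> real \<Rightarrow> real" where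
  "bump a b x = exp_inv 0 (x - a) * exp_inv 0 (b - x)"

lemma smooth_bump: "smooth (bump a b)"
proof -
  have "smooth (\<lambda>x. exp_inv 0 (x + - a) * exp_inv 0 (- x + b))"
    by (rule smooth_mult[OF smooth_compose_affine[OF bounded_linear_ident smooth_exp_inv]
          smooth_compose_affine[OF bounded_linear_minus[OF bounded_linear_ident] smooth_exp_inv]])
  then show ?thesis by (simp add: bump_def[abs_def])
qed

lemma bump_nonneg: "0 \<le> bump a b x"
  by (simp add: bump_def exp_inv_def)

lemma bump_pos_iff: "0 < bump a b x \<longleftrightarrow> a < x \<and> x < b"
  by (simp add: bump_def exp_inv_def)

lemma bump_eq_0: "x \<le> a \<or> b \<le> x \<Longrightarrow> bump a b x = 0"
  by (auto simp: bump_def exp_inv_def)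

section \<open>From distributions to an integral equation\<close>

text \<open>The value \<open>R d\<close> is the integral of \<rho>, in general not 0. A compactly
  supported function with prescribed derivative thus arises only as the difference of
  \<open>R\<close> and a translate.\<close>

lemma smooth_antiderivative:
  fixes \<rho> :: "real \<Rightarrow> real"
  assumes \<rho>: "smooth \<rho>" and zero: "\<And>x. x \<le> c \<or> d \<le> x \<Longrightarrow> \<rho> x = 0"
  obtains R where "smooth R" "\<And>x. (R has_vector_derivative \<rho> x) (at x)"
    "\<And>x. x \<le> c \<Longrightarrow> R x = 0" "\<And>x. d \<le> x \<Longrightarrow> R x = R d"
proof
  \<comment> \<open>The base point lies below \<open>c\<close> so that every \<open>x >= c\<close>
    is interior to the interval of integration and the derivative is two-sided.\<close>
  define R where "R x = integral {c - 1..x} \<rho>" for x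
  have cont: "continuous_on S \<rho>" for S
    using \<rho> by (rule smooth_imp_continuous_on)
  show R0: "R x = 0" if "x \<le> c" for x
    unfolding R_def using that zero by (intro integral_unique has_integral_is_0) auto
  show R': "(R has_vector_derivative \<rho> x) (at x)" for x
  proof (cases "x < c")
    case True
    have "((\<lambda>x. 0) has_vector_derivative (0::real)) (at x)" by simp
    then have "(R has_vector_derivative 0) (at x)"
      by (rule has_vector_derivative_transform_within_open[where S = "{..<c}"]) (use R0 True in auto)
    then show ?thesis using zero[of x] True by simp
  next
    case False
    have "(R has_vector_derivative \<rho> x) (at x within {c - 1..x + 1})"
      unfolding R_def by (rule integral_has_vector_derivative[OF cont]) (use False in auto)
    then show ?thesis
      using False by (simp add: at_within_Icc_at)
  qed
  show "R x = R d" if "d \<le> x" for x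
  proof -
    have "(\<rho> has_integral (R x - R d)) {d..x}"
      using that R' by (intro fundamental_theorem_of_calculus) (auto intro: has_vector_derivative_at_within)
    moreover have "(\<rho> has_integral 0) {d..x}"
      using zero by (intro has_integral_is_0) auto
    ultimately show ?thesis by (auto dest: has_integral_unique)
  qed
  show "smooth R"
    using R' \<rho> by (rule smooth_vector_derivativeI)
qed

text \<open>Compact support in the open interval, encoded by the margins \<open>c\<close> and
  \<open>d\<close>: these are what the product construction needs. The case \<open>d < c\<close>
  only gives the zero function.\<close>

definition test_functions_interval :: "real \<Rightarrow> real \<Rightarrow> (real \<Rightarrow> complex) set" where
  "test_functions_interval a b =
     {\<beta>. smooth \<beta> \<and> (\<exists>c d. a < c \<and> d < b \<and> (\<forall>x. x \<notin> {c..d} \<longrightarrow> \<beta> x = 0))}"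

text \<open>If the two values differed, \<open>G y = W (y + h) - W y\<close> would stay close to
  \<open>D\<close>, which is nonzero, for \<open>y\<close> near \<open>y0\<close>. Testing shows
  that \<open>G\<close> has average 0 against a bump there, a contradiction.\<close>

lemma du_Bois_Reymond:
  fixes W :: "real \<Rightarrow> complex"
  assumes cont: "continuous_on {a..b} W"
    and test: "\<And>\<beta>. \<beta> \<in> test_functions_interval a b \<Longrightarrow>
       integral {a..b} (\<lambda>y. W y * vector_derivative \<beta> (at y)) = 0"
    and y: "a < y0" "y0 < y1" "y1 < b"
  shows "W y1 = W y0"
proof (rule ccontr)
  assume ne: "W y1 \<noteq> W y0"
  define h where "h = y1 - y0"
  define G where "G y = W (y + h) - W y" for y
  define D where "D = W y1 - W y0"
  have h: "h > 0" and D: "D \<noteq> 0" and GD: "G y0 = D"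
    using ne y by (auto simp: h_def D_def G_def)
  have contG: "continuous_on {a..b - h} G"
    unfolding G_def using h
    by (intro continuous_on_diff continuous_on_compose2[OF cont] continuous_intros
        continuous_on_subset[OF cont]) auto
  moreover have "y0 \<in> {a..b - h}" using y by (auto simp: h_def)
  ultimately obtain \<delta>1 where \<delta>1: "\<delta>1 > 0"
    "\<And>y. y \<in> {a..b - h} \<Longrightarrow> dist y y0 < \<delta>1 \<Longrightarrow> dist (G y) (G y0) < norm D"
    using D unfolding continuous_on_iff by (metis zero_less_norm_iff)
  \<comment> \<open>Small enough that \<open>G\<close> differs from \<open>D\<close> by less than
    \<open>norm D\<close> on \<open>U\<close>, and that \<open>U\<close> and its translate by
    \<open>h\<close> stay inside the open interval.\<close>
  define \<delta> where "\<delta> = min \<delta>1 (min (y0 - a) (b - y1)) / 2"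
  have \<delta>: "\<delta> > 0" "\<delta> < \<delta>1" "a < y0 - \<delta>" "y1 + \<delta> < b"
    using \<delta>1(1) y by (auto simp: \<delta>_def min_def field_simps)
  define U where "U = {y0 - \<delta>..y0 + \<delta>}"
  have U: "U \<subseteq> {a..b - h}" "U \<subseteq> {a..b}"
    using \<delta> h y by (auto simp: U_def h_def)
  define \<rho> where "\<rho> = bump (y0 - \<delta>) (y0 + \<delta>)"
  have \<rho>0: "\<rho> x = 0" if "x \<le> y0 - \<delta> \<or> y0 + \<delta> \<le> x" for x
    using that by (simp add: \<rho>_def bump_eq_0)
  have \<rho>: "smooth \<rho>" by (simp add: \<rho>_def smooth_bump)
  obtain R where R: "smooth R" "\<And>x. (R has_vector_derivative \<rho> x) (at x)"
    "\<And>x. x \<le> y0 - \<delta> \<Longrightarrow> R x = 0" "\<And>x. y0 + \<delta> \<le> x \<Longrightarrow> R x = R (y0 + \<delta>)"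
    using smooth_antiderivative[OF \<rho> \<rho>0] by blast
  (* Testing with beta compares the averages of W near y0 and y1. *)
  define \<beta> where "\<beta> y = complex_of_real (R y) - complex_of_real (R (y - h))" for y
  have \<beta>': "(\<beta> has_vector_derivative (of_real (\<rho> y) - of_real (\<rho> (y - h)))) (at y)" for y
  proof -
    have "((\<lambda>y. R (y - h)) has_vector_derivative \<rho> (y - h)) (at y)"
      using vector_diff_chain_at[OF has_vector_derivative_diff[OF has_vector_derivative_id
            has_vector_derivative_const] R(2)]
      by (simp add: o_def)
    then show ?thesis
      unfolding \<beta>_def
      by (auto simp: has_real_derivative_iff_has_vector_derivative
          intro!: has_vector_derivative_diff has_vector_derivative_of_real R(2))
  qed
  have "smooth \<beta>"
  proof -
    have "smooth (\<lambda>y. complex_of_real (\<rho> y) + - complex_of_real (\<rho> (y + - h)))"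
      by (rule smooth_add[OF smooth_bounded_linear[OF bounded_linear_of_real \<rho>]
            smooth_bounded_linear[OF bounded_linear_minus[OF bounded_linear_of_real]
              smooth_compose_affine[OF bounded_linear_ident \<rho>]]])
    then show ?thesis
      by (intro smooth_vector_derivativeI[OF \<beta>']) simp
  qed
  moreover have "\<beta> x = 0" if "x \<notin> {y0 - \<delta>..y1 + \<delta>}" for x
  proof (cases "x < y0 - \<delta>")
    case True
    then show ?thesis using h by (simp add: \<beta>_def R(3))
  next
    case False
    then have "y0 + \<delta> \<le> x" "y0 + \<delta> \<le> x - h" using that h by (auto simp: h_def)
    then show ?thesis by (simp add: \<beta>_def R(4)[of x] R(4)[of "x - h"])
  qed
  ultimately have "\<beta> \<in> test_functions_interval a b"
    unfolding test_functions_interval_def using \<delta> by blast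
  from test[OF this] have 0: "integral {a..b} (\<lambda>y. W y * (of_real (\<rho> y) - of_real (\<rho> (y - h)))) = 0"
    by (simp add: vector_derivative_at[OF \<beta>'])
  have cont\<rho>: "continuous_on S \<rho>" for S
    using \<rho> by (rule smooth_imp_continuous_on)
  have int1: "(\<lambda>y. W y * of_real (\<rho> y)) integrable_on U"
    and int2: "(\<lambda>y. W (y + h) * of_real (\<rho> y)) integrable_on U"
    unfolding U_def using U h
    by (auto intro!: integrable_continuous_real continuous_intros cont\<rho>
        continuous_on_compose2[OF cont] simp: U_def)
  define I1 I2 where "I1 = integral U (\<lambda>y. W y * of_real (\<rho> y))"
    and "I2 = integral U (\<lambda>y. W (y + h) * of_real (\<rho> y))"
  have "((\<lambda>y. W y * of_real (\<rho> y)) has_integral I1) U"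
    using int1 by (simp add: I1_def integrable_integral)
  then have 1: "((\<lambda>y. W y * of_real (\<rho> y)) has_integral I1) {a..b}"
    by (rule has_integral_on_superset[OF _ _ U(2)]) (auto simp: U_def intro!: \<rho>0)
  have "((\<lambda>y. W (y + h) * of_real (\<rho> y)) has_integral I2) U"
    using int2 by (simp add: I2_def integrable_integral)
  then have "((\<lambda>y. W y * of_real (\<rho> (y - h))) has_integral I2) {y0 - \<delta> + h..y0 + \<delta> + h}"
    unfolding U_def using has_integral_shift_Icc_real[of "\<lambda>y. W y * of_real (\<rho> (y - h))" h I2 "y0 - \<delta>" "y0 + \<delta>"]
    by (simp add: o_def add.commute)
  then have 2: "((\<lambda>y. W y * of_real (\<rho> (y - h))) has_integral I2) {a..b}"
    by (rule has_integral_on_superset) (use \<delta> h in \<open>auto simp: h_def intro!: \<rho>0\<close>)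
  have "I1 - I2 = 0"
    using integral_unique[OF has_integral_diff[OF 1 2]] 0 by (simp add: right_diff_distrib)
  then have I: "integral U (\<lambda>y. G y * of_real (\<rho> y)) = 0"
    using integral_diff[OF int2 int1] by (simp add: I1_def I2_def G_def left_diff_distrib)
  \<comment> \<open>Multiplying by \<open>cnj D\<close> and taking real parts turns closeness of
    \<open>G\<close> to \<open>D\<close> into a sign: the result is nonnegative on \<open>U\<close>,
    positive at \<open>y0\<close>, and has integral 0.\<close>
  define g where "g y = Re (cnj D * (G y * of_real (\<rho> y)))" for y
  have intG: "(\<lambda>y. G y * of_real (\<rho> y)) integrable_on U"
    unfolding G_def left_diff_distrib by (rule integrable_diff[OF int2 int1])
  have "bounded_linear (\<lambda>z. Re (cnj D * z))"
    using bounded_linear_compose[OF bounded_linear_Re bounded_linear_mult_right[of "cnj D"]] by (simp add: o_def)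
  from integral_linear[OF intG this] have "integral U g = 0"
    by (simp add: o_def g_def[abs_def] I)
  moreover have "g y \<ge> 0" if "y \<in> U" for y
  proof -
    have "dist y y0 < \<delta>1" using that \<delta> by (auto simp: U_def dist_real_def)
    then have "norm (G y - D) < norm D"
      using \<delta>1(2)[of y] that U GD by (auto simp: dist_norm)
    then have "norm (cnj D * (G y - D)) \<le> norm D * norm D"
      by (simp add: norm_mult mult_left_mono)
    then have "\<bar>Re (cnj D * (G y - D))\<bar> \<le> norm D * norm D"
      using abs_Re_le_cmod order_trans by blast
    moreover have "Re (cnj D * D) = norm D * norm D"
      by (simp add: cmod_power2 flip: power2_eq_square)
    ultimately have "0 \<le> Re (cnj D * G y)"
      by (simp add: right_diff_distrib)
    then have "0 \<le> Re (cnj D * G y) * \<rho> y"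
      by (simp add: \<rho>_def bump_nonneg)
    also have "Re (cnj D * G y) * \<rho> y = g y"
      unfolding g_def mult.assoc[symmetric] times_complex.sel(1)[of _ "of_real _"] by simp
    finally show ?thesis .
  qed
  moreover have "continuous_on U g"
    unfolding g_def by (intro continuous_intros cont\<rho> continuous_on_subset[OF contG U(1)])
  ultimately have "g y0 = 0"
    using integral_eq_0_iff[of "y0 - \<delta>" "y0 + \<delta>" g] \<delta> by (auto simp: U_def)
  moreover have "g y0 = (norm D)\<^sup>2 * \<rho> y0"
    unfolding g_def GD mult.assoc[symmetric] times_complex.sel(1)[of _ "of_real _"]
    using cmod_power2[of D] by (simp flip: power2_eq_square)
  moreover have "\<rho> y0 > 0" using \<delta> by (simp add: \<rho>_def bump_pos_iff)
  ultimately show False using D by simp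
qed

text \<open>The tested identity says \<open>H' = K\<close> weakly. Subtracting an antiderivative of
  \<open>K\<close> leaves zero weak derivative, hence a constant in the open interval; continuity
  carries this to the endpoints, where the result is later evaluated.\<close>

lemma weak_derivative_imp_integral:
  fixes H K :: "real \<Rightarrow> complex"
  assumes "a < b" and contH: "continuous_on {a..b} H" and contK: "continuous_on {a..b} K"
    and test: "\<And>\<beta>. \<beta> \<in> test_functions_interval a b \<Longrightarrow>
       integral {a..b} (\<lambda>y. H y * vector_derivative \<beta> (at y)) +
       integral {a..b} (\<lambda>y. K y * \<beta> y) = 0"
    and "y \<in> {a..b}"
  shows "H y = H a + integral {a..y} K"
proof -
  define P where "P y = integral {a..y} K" for y
  have P': "(P has_vector_derivative K y) (at y within {a..b})" if "y \<in> {a..b}" for y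
    unfolding P_def by (rule integral_has_vector_derivative[OF contK that])
  have contP: "continuous_on {a..b} P"
    unfolding continuous_on_eq_continuous_within
    using P' has_vector_derivative_continuous by blast
  define W where "W y = H y - P y" for y
  have contW: "continuous_on {a..b} W"
    unfolding W_def by (intro continuous_intros contH contP)
  have W: "integral {a..b} (\<lambda>y. W y * vector_derivative \<beta> (at y)) = 0"
    if \<beta>: "\<beta> \<in> test_functions_interval a b" for \<beta>
  proof -
    have sm: "smooth \<beta>" and zero: "\<beta> a = 0" "\<beta> b = 0"
      using \<beta> \<open>a < b\<close> by (auto simp: test_functions_interval_def)
    note cont\<beta> = smooth_imp_continuous_on[OF sm] smooth_imp_continuous_on[OF smooth_vector_derivative[OF sm]]
    have "((\<lambda>y. P y * vector_derivative \<beta> (at y) + K y * \<beta> y) has_integral (P b * \<beta> b - P a * \<beta> a)) {a..b}"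
      using \<open>a < b\<close>
      by (intro fundamental_theorem_of_calculus has_vector_derivative_mult P'
          has_vector_derivative_at_within[OF smooth_has_vector_derivative[OF sm]]) auto
    then have "integral {a..b} (\<lambda>y. P y * vector_derivative \<beta> (at y) + K y * \<beta> y) = 0"
      by (auto simp: zero dest: integral_unique)
    moreover have "integral {a..b} (\<lambda>y. P y * vector_derivative \<beta> (at y) + K y * \<beta> y) =
        integral {a..b} (\<lambda>y. P y * vector_derivative \<beta> (at y)) + integral {a..b} (\<lambda>y. K y * \<beta> y)"
      by (intro integral_add integrable_continuous_real continuous_on_mult contP contK cont\<beta>)
    moreover have "integral {a..b} (\<lambda>y. W y * vector_derivative \<beta> (at y)) =
        integral {a..b} (\<lambda>y. H y * vector_derivative \<beta> (at y)) - integral {a..b} (\<lambda>y. P y * vector_derivative \<beta> (at y))"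
      unfolding W_def left_diff_distrib
      by (intro integral_diff integrable_continuous_real continuous_on_mult contP contH cont\<beta>)
    ultimately show ?thesis using test[OF \<beta>] by algebra
  qed
  define m where "m = (a + b) / 2"
  have m: "a < m" "m < b" using \<open>a < b\<close> by (auto simp: m_def)
  have const: "W x = W m" if "x \<in> {a<..<b}" for x
    using du_Bois_Reymond[OF contW W, of x m] du_Bois_Reymond[OF contW W, of m x] that m
    by (cases x m rule: linorder_cases) auto
  have "W x = W m" if "x \<in> {a..b}" for x
    using continuous_constant_on_closure[of "{a<..<b}" W "W m" x] const contW that \<open>a < b\<close> by simp
  from this[of y] this[of a] have "W y = W a" using assms(1,5) by simp
  then show ?thesis by (simp add: W_def P_def diff_eq_eq)
qed

section \<open>Separation of variables in the weak equation\<close>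

lemma test_functions_interval_vector_derivative:
  assumes "\<alpha> \<in> test_functions_interval a b"
  shows "(\<lambda>x. vector_derivative \<alpha> (at x)) \<in> test_functions_interval a b"
proof -
  obtain c d where cd: "a < c" "d < b" and zero: "\<And>x. x \<notin> {c..d} \<Longrightarrow> \<alpha> x = 0" and sm: "smooth \<alpha>"
    using assms by (auto simp: test_functions_interval_def)
  have "vector_derivative \<alpha> (at x) = 0" if "x \<notin> {c..d}" for x
  proof (rule vector_derivative_at)
    have "((\<lambda>x. 0) has_vector_derivative (0::complex)) (at x)" by simp
    then show "(\<alpha> has_vector_derivative 0) (at x)"
      by (rule has_vector_derivative_transform_within_open[where S = "- {c..d}"])
        (use that zero in auto)
  qed
  then show ?thesis
    using smooth_vector_derivative[OF sm] cd by (auto simp: test_functions_interval_def)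
qed

lemma product_in_test_functions:
  assumes \<alpha>: "\<alpha> \<in> test_functions_interval a b" and \<beta>: "\<beta> \<in> test_functions_interval a' b'"
    and sub: "{a<..<b} \<times> {a'<..<b'} \<subseteq> \<Omega>"
  shows "(\<lambda>z. \<alpha> (fst z) * \<beta> (snd z)) \<in> test_functions \<Omega>"
proof -
  obtain c d where cd: "a < c" "d < b" and zero: "\<And>x. x \<notin> {c..d} \<Longrightarrow> \<alpha> x = 0" and sm: "smooth \<alpha>"
    using \<alpha> by (auto simp: test_functions_interval_def)
  obtain c' d' where cd': "a' < c'" "d' < b'" and zero': "\<And>x. x \<notin> {c'..d'} \<Longrightarrow> \<beta> x = 0" and sm': "smooth \<beta>"
    using \<beta> by (auto simp: test_functions_interval_def)
  let ?\<phi> = "\<lambda>z. \<alpha> (fst z) * \<beta> (snd z)"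
  have "smooth ?\<phi>"
    using smooth_mult[OF smooth_compose_affine[OF bounded_linear_fst sm, of 0]
        smooth_compose_affine[OF bounded_linear_snd sm', of 0]]
    by (simp add: case_prod_unfold)
  moreover have supp: "closure {z. ?\<phi> z \<noteq> 0} \<subseteq> {c..d} \<times> {c'..d'}"
  proof (intro closure_minimal closed_Times subsetI)
    fix z assume "z \<in> {z. ?\<phi> z \<noteq> 0}"
    then have "fst z \<in> {c..d}" "snd z \<in> {c'..d'}" using zero zero' by auto
    then show "z \<in> {c..d} \<times> {c'..d'}" by (simp add: mem_Times_iff)
  qed auto
  moreover have "compact (closure {z. ?\<phi> z \<noteq> 0})"
    unfolding compact_closure
    by (rule bounded_subset[OF bounded_Times[OF bounded_closed_interval bounded_closed_interval]
          order_trans[OF closure_subset supp]])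
  moreover have "{c..d} \<times> {c'..d'} \<subseteq> \<Omega>"
    using cd cd' by (intro order_trans[OF _ sub]) auto
  ultimately show ?thesis
    unfolding test_functions_def by (intro CollectI conjI; blast)
qed

text \<open>The closed rectangle may stick out of \<Omega> along its boundary, which happens at the
  axes of the quarter-plane. The product vanishes near that boundary, so both domains give the same
  integral.\<close>

lemma regular_distribution_product:
  assumes cont: "continuous_on ({A..B} \<times> {A'..B'}) u" and sub: "{A<..<B} \<times> {A'<..<B'} \<subseteq> \<Omega>"
    and a: "a \<in> test_functions_interval A B" and b: "b \<in> test_functions_interval A' B'"
  shows "regular_distribution \<Omega> u (\<lambda>z. a (fst z) * b (snd z)) =
    integral {A..B} (\<lambda>x. integral {A'..B'} (\<lambda>y. u (x, y) * (a x * b y)))"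
proof -
  let ?f = "\<lambda>z. u z * (a (fst z) * b (snd z))"
  let ?C = "cbox (A, A') (B, B')"
  have C: "?C = {A..B} \<times> {A'..B'}" by (simp add: cbox_Pair_eq)
  obtain c d where cd: "A < c" "d < B" and zero: "\<And>x. x \<notin> {c..d} \<Longrightarrow> a x = 0" and sm: "smooth a"
    using a by (auto simp: test_functions_interval_def)
  obtain c' d' where cd': "A' < c'" "d' < B'" and zero': "\<And>x. x \<notin> {c'..d'} \<Longrightarrow> b x = 0" and sm': "smooth b"
    using b by (auto simp: test_functions_interval_def)
  have contf: "continuous_on ?C ?f"
    unfolding C
    by (intro continuous_on_mult cont continuous_on_compose2[OF smooth_imp_continuous_on[OF sm, of UNIV]]
       continuous_on_compose2[OF smooth_imp_continuous_on[OF sm', of UNIV]] continuous_intros) auto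
  have "indicator \<Omega> z *\<^sub>R ?f z = indicator ?C z *\<^sub>R ?f z" for z
  proof (cases "fst z \<in> {c..d} \<and> snd z \<in> {c'..d'}")
    case True
    then have "z \<in> {A<..<B} \<times> {A'<..<B'}" using cd cd' by (auto simp: mem_Times_iff)
    then have "z \<in> \<Omega>" "z \<in> ?C" using sub unfolding C by (auto simp: mem_Times_iff)
    then show ?thesis by simp
  next
    case False
    then have "?f z = 0" using zero zero' by auto
    then show ?thesis by simp
  qed
  then have "regular_distribution \<Omega> u (\<lambda>z. a (fst z) * b (snd z)) = (LINT z:?C|lborel. ?f z)"
    by (simp only: regular_distribution_def set_lebesgue_integral_def)
  also have "\<dots> = integral ?C ?f"
    by (rule set_borel_integral_eq_integral)
      (simp add: set_integrable_def borel_integrable_compact[OF compact_cbox contf])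
  also have "\<dots> = integral {A..B} (\<lambda>x. integral {A'..B'} (\<lambda>y. u (x, y) * (a x * b y)))"
    using integral_prod_continuous[OF contf] by simp
  finally show ?thesis .
qed

lemma Klein_Gordon_distr_product:
  assumes cont: "continuous_on ({A..B} \<times> {A'..B'}) u" and sub: "{A<..<B} \<times> {A'<..<B'} \<subseteq> \<Omega>"
    and KG: "Klein_Gordon_distr \<Omega> u"
    and \<alpha>: "\<alpha> \<in> test_functions_interval A B" and \<beta>: "\<beta> \<in> test_functions_interval A' B'"
  shows "integral {A..B} (\<lambda>x. integral {A'..B'} (\<lambda>y.
           u (x, y) * (vector_derivative \<alpha> (at x) * vector_derivative \<beta> (at y)))) +
         integral {A..B} (\<lambda>x. integral {A'..B'} (\<lambda>y. u (x, y) * (\<alpha> x * \<beta> y))) = 0"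
proof -
  let ?\<phi> = "\<lambda>z. \<alpha> (fst z) * \<beta> (snd z)"
  have sm: "smooth \<alpha>" "smooth \<beta>"
    using \<alpha> \<beta> by (auto simp: test_functions_interval_def)
  have dx: "partial_x ?\<phi> = (\<lambda>z. vector_derivative \<alpha> (at (fst z)) * \<beta> (snd z))"
    unfolding partial_x_def
    by (auto intro!: vector_derivative_at has_vector_derivative_mult_left smooth_has_vector_derivative sm)
  have dy: "partial_y (\<lambda>z. vector_derivative \<alpha> (at (fst z)) * \<beta> (snd z)) =
      (\<lambda>z. vector_derivative \<alpha> (at (fst z)) * vector_derivative \<beta> (at (snd z)))"
    unfolding partial_y_def
    by (auto intro!: vector_derivative_at has_vector_derivative_mult_right smooth_has_vector_derivative sm)
  have "regular_distribution \<Omega> u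
      (\<lambda>z. vector_derivative \<alpha> (at (fst z)) * vector_derivative \<beta> (at (snd z))) +
    regular_distribution \<Omega> u ?\<phi> = 0"
    using KG product_in_test_functions[OF \<alpha> \<beta> sub]
    unfolding Klein_Gordon_distr_def distr_dx_def distr_dy_def by (fastforce simp: dx dy)
  then show ?thesis
    unfolding regular_distribution_product[OF cont sub \<alpha> \<beta>]
      regular_distribution_product[OF cont sub \<alpha>[THEN test_functions_interval_vector_derivative]
        \<beta>[THEN test_functions_interval_vector_derivative]] .
qed

text \<open>The test factors are removed one variable at a time by the one-variable result on weak
  derivatives. As \<open>u\<close> is continuous up to the boundary, the edges \<open>A\<close> and
  \<open>A'\<close> may lie on the axes.\<close>

lemma Klein_Gordon_distr_imp_integral_equation:
  assumes cont: "continuous_on ({A..B} \<times> {A'..B'}) u" and sub: "{A<..<B} \<times> {A'<..<B'} \<subseteq> \<Omega>"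
    and KG: "Klein_Gordon_distr \<Omega> u"
    and AB: "A < B" "A' < B'" and x: "x \<in> {A..B}" and y: "y \<in> {A'..B'}"
  shows "u (x, y) - u (x, A') = u (A, y) - u (A, A') - integral {A..x} (\<lambda>s. integral {A'..y} (\<lambda>t. u (s, t)))"
proof -
  have cont': "continuous_on ({A'..B'} \<times> {A..B}) (\<lambda>(y, x). u (x, y))"
    using continuous_on_swap_args[of "{A..B}" "{A'..B'}" "\<lambda>x y. u (x, y)"] cont by simp
  have contx: "continuous_on {A..B} (\<lambda>x. u (x, t))" if "t \<in> {A'..B'}" for t
    using that by (intro continuous_on_compose2[OF cont] continuous_intros) auto
  \<comment> \<open>With \<alpha> fixed, the averages of \<open>u\<close> against its derivative and
    against \<alpha> itself play the roles of \<open>H\<close> and \<open>K\<close> in the variable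
    \<open>y\<close>.\<close>
  have step1: "integral {A..B} (\<lambda>x. u (x, y) * vector_derivative \<alpha> (at x)) =
      integral {A..B} (\<lambda>x. u (x, A') * vector_derivative \<alpha> (at x)) +
      integral {A'..y} (\<lambda>y. integral {A..B} (\<lambda>x. u (x, y) * \<alpha> x))"
    if \<alpha>: "\<alpha> \<in> test_functions_interval A B" for \<alpha>
  proof (rule weak_derivative_imp_integral[OF AB(2) _ _ _ y])
    have sm: "smooth \<alpha>" using \<alpha> by (auto simp: test_functions_interval_def)
    note cont\<alpha> = smooth_imp_continuous_on[OF sm] smooth_imp_continuous_on[OF smooth_vector_derivative[OF sm]]
    have prod: "continuous_on ({A'..B'} \<times> cbox A B) (\<lambda>(y, x). u (x, y) * g x)"
      if "continuous_on UNIV g" for g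
      using cont' unfolding case_prod_unfold cbox_interval
      by (rule continuous_on_mult) (rule continuous_on_compose2[OF that], auto intro: continuous_intros)
    show "continuous_on {A'..B'} (\<lambda>y. integral {A..B} (\<lambda>x. u (x, y) * vector_derivative \<alpha> (at x)))"
      using integral_continuous_on_param[OF prod[OF cont\<alpha>(2)]] by simp
    show "continuous_on {A'..B'} (\<lambda>y. integral {A..B} (\<lambda>x. u (x, y) * \<alpha> x))"
      using integral_continuous_on_param[OF prod[OF cont\<alpha>(1)]] by simp
    fix \<beta> assume \<beta>: "\<beta> \<in> test_functions_interval A' B'"
    have sm': "smooth \<beta>" using \<beta> by (auto simp: test_functions_interval_def)
    note cont\<beta> = smooth_imp_continuous_on[OF sm'] smooth_imp_continuous_on[OF smooth_vector_derivative[OF sm']]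
    have swap: "integral {A'..B'} (\<lambda>y. integral {A..B} (\<lambda>x. u (x, y) * g x) * h y) =
      integral {A..B} (\<lambda>x. integral {A'..B'} (\<lambda>y. u (x, y) * (g x * h y)))"
      if g: "continuous_on UNIV g" and h: "continuous_on UNIV h" for g h
    proof -
      have "continuous_on (cbox (A', A) (B', B)) (\<lambda>(y, x). u (x, y) * (g x * h y))"
        using cont' unfolding case_prod_unfold cbox_Pair_eq box_real
        by (rule continuous_on_mult)
          (intro continuous_on_mult continuous_on_compose2[OF g] continuous_on_compose2[OF h] continuous_intros; simp)
      from integral_swap_continuous[OF this]
      have "integral {A'..B'} (\<lambda>y. integral {A..B} (\<lambda>x. u (x, y) * (g x * h y))) =
          integral {A..B} (\<lambda>x. integral {A'..B'} (\<lambda>y. u (x, y) * (g x * h y)))"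
        by simp
      then show ?thesis by (simp flip: mult.assoc integral_mult_left)
    qed
    show "integral {A'..B'} (\<lambda>y. integral {A..B} (\<lambda>x. u (x, y) * vector_derivative \<alpha> (at x)) *
          vector_derivative \<beta> (at y)) +
        integral {A'..B'} (\<lambda>y. integral {A..B} (\<lambda>x. u (x, y) * \<alpha> x) * \<beta> y) = 0"
      unfolding swap[OF cont\<alpha>(2) cont\<beta>(2)] swap[OF cont\<alpha>(1) cont\<beta>(1)]
      by (rule Klein_Gordon_distr_product[OF cont sub KG \<alpha> \<beta>])
  qed
  \<comment> \<open>Now \<open>y\<close> is fixed and the remaining identity in \<alpha> is again a
    weak derivative, this time in \<open>x\<close>; Fubini has moved the \<open>y\<close>-integral
    inside.\<close>
  have "(\<lambda>x. u (x, y) - u (x, A')) x = (\<lambda>x. u (x, y) - u (x, A')) A +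
      integral {A..x} (\<lambda>s. - integral {A'..y} (\<lambda>t. u (s, t)))"
  proof (rule weak_derivative_imp_integral[OF AB(1) _ _ _ x])
    show "continuous_on {A..B} (\<lambda>x. u (x, y) - u (x, A'))"
      using AB y by (intro continuous_on_diff contx) auto
    have "continuous_on ({A..B} \<times> cbox A' y) (\<lambda>(s, t). u (s, t))"
      unfolding case_prod_eta using y by (intro continuous_on_subset[OF cont]) auto
    then show contK: "continuous_on {A..B} (\<lambda>s. - integral {A'..y} (\<lambda>t. u (s, t)))"
      using integral_continuous_on_param by (intro continuous_on_minus) fastforce
    fix \<alpha> assume \<alpha>: "\<alpha> \<in> test_functions_interval A B"
    have sm: "smooth \<alpha>" using \<alpha> by (auto simp: test_functions_interval_def)
    note cont\<alpha> = smooth_imp_continuous_on[OF sm] smooth_imp_continuous_on[OF smooth_vector_derivative[OF sm]]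
    have "continuous_on (cbox (A', A) (y, B)) (\<lambda>(y, x). u (x, y) * \<alpha> x)"
      using y unfolding case_prod_unfold cbox_Pair_eq box_real
      by (intro continuous_on_mult continuous_on_compose2[OF cont'[unfolded case_prod_unfold], of _ "\<lambda>z. z", simplified]
            continuous_on_compose2[OF cont\<alpha>(1)[of UNIV]] continuous_intros) auto
    from integral_swap_continuous[OF this]
    have "integral {A'..y} (\<lambda>y. integral {A..B} (\<lambda>x. u (x, y) * \<alpha> x)) =
        integral {A..B} (\<lambda>x. integral {A'..y} (\<lambda>t. u (x, t)) * \<alpha> x)"
      by (simp flip: integral_mult_left)
    moreover have "integral {A..B} (\<lambda>x. (u (x, y) - u (x, A')) * vector_derivative \<alpha> (at x)) =
        integral {A..B} (\<lambda>x. u (x, y) * vector_derivative \<alpha> (at x)) -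
        integral {A..B} (\<lambda>x. u (x, A') * vector_derivative \<alpha> (at x))"
      unfolding left_diff_distrib using AB y
      by (intro integral_diff integrable_continuous_real continuous_on_mult contx cont\<alpha>) auto
    ultimately show "integral {A..B} (\<lambda>x. (u (x, y) - u (x, A')) * vector_derivative \<alpha> (at x)) +
        integral {A..B} (\<lambda>x. - integral {A'..y} (\<lambda>t. u (x, t)) * \<alpha> x) = 0"
      using step1[OF \<alpha>] by simp
  qed
  then show ?thesis by simp
qed

section \<open>A Gronwall estimate\<close>

lemma has_integral_exp_0:
  fixes c b :: real
  assumes "c > 0" "b \<ge> 0"
  shows "((\<lambda>x. exp (c * x)) has_integral (exp (c * b) - 1) / c) {0..b}"
proof -
  have "((\<lambda>x. exp (c * x)) has_integral exp (c * b) / c - exp (c * 0) / c) {0..b}"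
    using assms
    by (intro fundamental_theorem_of_calculus)
      (auto intro!: derivative_eq_intros simp flip: has_real_derivative_iff_has_vector_derivative)
  then show ?thesis by (simp add: diff_divide_distrib)
qed

text \<open>In the weight \<open>exp (\<mu> x + 2 t / \<mu>)\<close> the double integral operator has norm at most \<open>1/2\<close>.\<close>

lemma quadrant_Gronwall:
  fixes n :: "real \<Rightarrow> real \<Rightarrow> real"
  assumes cont: "continuous_on ({0..} \<times> {0..T}) (\<lambda>(x, t). n x t)"
    and nonneg: "\<And>x t. 0 \<le> n x t" and "\<mu> > 0"
    and le: "\<And>x t. 0 \<le> x \<Longrightarrow> t \<in> {0..T} \<Longrightarrow>
      n x t \<le> C * exp (\<mu> * x) + integral {0..t} (\<lambda>\<tau>. integral {0..x} (\<lambda>\<xi>. n \<xi> \<tau>))"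
    and x: "0 \<le> x" and t: "t \<in> {0..T}"
  shows "n x t \<le> 2 * C * exp (\<mu> * x + 2 / \<mu> * t)"
proof -
  have C: "C \<ge> 0" using le[of 0 0] nonneg[of 0 0] t by simp
  define e where "e x t = exp (\<mu> * x) * exp (2 / \<mu> * t)" for x t
  have e_pos: "e x t > 0" for x t by (simp add: e_def)
  have cont': "continuous_on ({0..x} \<times> {0..T}) (\<lambda>(x, t). n x t)"
    by (rule continuous_on_subset[OF cont]) auto
  have "continuous_on ({0..x} \<times> {0..T}) (\<lambda>z. (case z of (x, t) \<Rightarrow> n x t) / e (fst z) (snd z))"
    unfolding e_def by (intro continuous_intros cont') auto
  moreover have nonempty: "{0..x} \<times> {0..T} \<noteq> {}" using x t by auto
  ultimately obtain z where z: "z \<in> {0..x} \<times> {0..T}"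
    and max: "\<And>z'. z' \<in> {0..x} \<times> {0..T} \<Longrightarrow>
        (case z' of (x, t) \<Rightarrow> n x t) / e (fst z') (snd z') \<le> (case z of (x, t) \<Rightarrow> n x t) / e (fst z) (snd z)"
    using continuous_attains_sup[OF compact_Times[OF compact_Icc compact_Icc] nonempty] by blast
  obtain x1 t1 where z_eq: "z = (x1, t1)" by (cases z)
  \<comment> \<open>The largest ratio of \<open>n\<close> to the weight on the compact rectangle.
    The hypothesis is used at the maximizing point, whose domain of integration stays inside the
    rectangle.\<close>
  define A where "A = n x1 t1 / e x1 t1"
  have x1: "0 \<le> x1" "x1 \<le> x" and t1: "0 \<le> t1" "t1 \<le> T" using z by (auto simp: z_eq)
  have A: "A \<ge> 0" using nonneg e_pos[of x1 t1] by (simp add: A_def)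
  have nA: "n \<xi> \<tau> \<le> A * e \<xi> \<tau>" if "\<xi> \<in> {0..x}" "\<tau> \<in> {0..T}" for \<xi> \<tau>
    using max[of "(\<xi>, \<tau>)"] that e_pos[of \<xi> \<tau>] by (simp add: z_eq A_def pos_divide_le_eq)
  have contI: "continuous_on ({0..t1} \<times> {0..x1}) (\<lambda>(\<tau>, \<xi>). n \<xi> \<tau>)"
    by (rule continuous_on_swap_args) (rule continuous_on_subset[OF cont], use t1 in auto)
  have inner: "integral {0..x1} (\<lambda>\<xi>. n \<xi> \<tau>) \<le> A * exp (\<mu> * x1) / \<mu> * exp (2 / \<mu> * \<tau>)"
    if \<tau>: "\<tau> \<in> {0..t1}" for \<tau>
  proof -
    have I: "((\<lambda>\<xi>. A * exp (2 / \<mu> * \<tau>) * exp (\<mu> * \<xi>)) has_integral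
        A * exp (2 / \<mu> * \<tau>) * ((exp (\<mu> * x1) - 1) / \<mu>)) {0..x1}"
      using \<open>\<mu> > 0\<close> x1 by (intro has_integral_mult_right has_integral_exp_0) auto
    have "continuous_on {0..x1} (\<lambda>\<xi>. (\<lambda>(x, t). n x t) (\<xi>, \<tau>))"
      by (rule continuous_on_compose2[OF cont]) (use \<tau> t1 in \<open>auto intro!: continuous_intros\<close>)
    then have "(\<lambda>\<xi>. n \<xi> \<tau>) integrable_on {0..x1}"
      by (intro integrable_continuous_real) simp
    moreover have "n \<xi> \<tau> \<le> A * exp (2 / \<mu> * \<tau>) * exp (\<mu> * \<xi>)" if "\<xi> \<in> {0..x1}" for \<xi>
    proof -
      have "n \<xi> \<tau> \<le> A * e \<xi> \<tau>" using that x1 \<tau> t1 by (intro nA) auto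
      then show ?thesis by (simp only: e_def mult.assoc mult.commute mult.left_commute)
    qed
    ultimately have "integral {0..x1} (\<lambda>\<xi>. n \<xi> \<tau>) \<le> A * exp (2 / \<mu> * \<tau>) * ((exp (\<mu> * x1) - 1) / \<mu>)"
      using integral_le[OF _ has_integral_integrable[OF I]] unfolding integral_unique[OF I] by blast
    also have "\<dots> \<le> A * exp (2 / \<mu> * \<tau>) * (exp (\<mu> * x1) / \<mu>)"
      using A \<open>\<mu> > 0\<close> by (intro mult_left_mono divide_right_mono) auto
    finally show ?thesis by (simp add: algebra_simps)
  qed
  have I: "((\<lambda>\<tau>. A * exp (\<mu> * x1) / \<mu> * exp (2 / \<mu> * \<tau>)) has_integral
        A * exp (\<mu> * x1) / \<mu> * ((exp (2 / \<mu> * t1) - 1) / (2 / \<mu>))) {0..t1}"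
    using \<open>\<mu> > 0\<close> t1 by (intro has_integral_mult_right has_integral_exp_0) auto
  have "(\<lambda>\<tau>. integral {0..x1} (\<lambda>\<xi>. n \<xi> \<tau>)) integrable_on {0..t1}"
    using integral_continuous_on_param[of "{0..t1}" 0 x1 "\<lambda>\<tau> \<xi>. n \<xi> \<tau>"] contI
    by (intro integrable_continuous_real) simp
  then have "integral {0..t1} (\<lambda>\<tau>. integral {0..x1} (\<lambda>\<xi>. n \<xi> \<tau>)) \<le>
      A * exp (\<mu> * x1) / \<mu> * ((exp (2 / \<mu> * t1) - 1) / (2 / \<mu>))"
    using integral_le[OF _ has_integral_integrable[OF I] inner] unfolding integral_unique[OF I] by blast
  also have "\<dots> = A * exp (\<mu> * x1) * (exp (2 / \<mu> * t1) - 1) / 2"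
    using \<open>\<mu> > 0\<close> by simp
  also have "\<dots> \<le> A * exp (\<mu> * x1) * exp (2 / \<mu> * t1) / 2"
    using A by (intro divide_right_mono mult_left_mono) auto
  finally have "n x1 t1 \<le> C * exp (\<mu> * x1) + A * e x1 t1 / 2"
    using le[of x1 t1] x1 t1 by (simp add: e_def mult.assoc)
  moreover have "C * exp (\<mu> * x1) * 1 \<le> C * exp (\<mu> * x1) * exp (2 / \<mu> * t1)"
    using C t1 \<open>\<mu> > 0\<close> by (intro mult_left_mono) auto
  then have "C * exp (\<mu> * x1) \<le> C * e x1 t1" by (simp add: e_def mult.assoc)
  moreover have "n x1 t1 = A * e x1 t1"
    using e_pos[of x1 t1] by (simp add: A_def)
  \<comment> \<open>Integration in \<xi> costs a factor \<open>1/\<mu>\<close> and integration in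
    \<tau> a factor \<open>\<mu>/2\<close>, so half of \<open>A\<close> can be absorbed on the
    left.\<close>
  ultimately have "A * e x1 t1 \<le> (C + A / 2) * e x1 t1"
    unfolding distrib_right by linarith
  then have "A \<le> 2 * C" using e_pos[of x1 t1] by simp
  have "n x t \<le> A * e x t" using x t by (intro nA) auto
  also have "\<dots> \<le> 2 * C * e x t"
    using \<open>A \<le> 2 * C\<close> e_pos[of x t] by (intro mult_right_mono) auto
  finally show ?thesis by (simp add: e_def exp_add)
qed

section \<open>Laplace transforms\<close>

definition laplace :: "(real \<Rightarrow> complex) \<Rightarrow> complex \<Rightarrow> complex" where
  "laplace h p = integral {0..} (\<lambda>x. exp (- p * of_real x) * h x)"

text \<open>One tail estimate serves several purposes: \<open>X = 0\<close> gives the norm bound,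
  letting \<open>X\<close> grow gives convergence of the truncated integrals, and its uniformity
  where \<open>Re p - \<mu>\<close> is bounded below gives holomorphy.\<close>

lemma laplace_tail:
  assumes cont: "continuous_on {0..} h" and bound: "\<And>x. 0 \<le> x \<Longrightarrow> norm (h x) \<le> C * exp (\<mu> * x)"
    and p: "\<mu> < Re p" and X: "0 \<le> X"
  shows "norm (laplace h p - integral {0..X} (\<lambda>x. exp (- p * of_real x) * h x))
    \<le> C * exp (- (Re p - \<mu>) * X) / (Re p - \<mu>)"
    and "(\<lambda>x. exp (- p * of_real x) * h x) integrable_on {0..}"
proof -
  let ?f = "\<lambda>x. exp (- p * of_real x) * h x"
  have contf: "continuous_on S ?f" if "S \<subseteq> {0..}" for S
    by (intro continuous_intros continuous_on_subset[OF cont that])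
  have nf: "norm (?f x) \<le> C * exp (- (Re p - \<mu>) * x)" if "0 \<le> x" for x
  proof -
    have "norm (?f x) \<le> exp (- Re p * x) * (C * exp (\<mu> * x))"
      unfolding norm_mult norm_exp_eq_Re using bound[OF that] by (intro mult_mono) auto
    also have "\<dots> = C * exp (- (Re p - \<mu>) * x)"
      by (simp add: algebra_simps flip: exp_add)
    finally show ?thesis .
  qed
  have dom: "((\<lambda>x. C * exp (- (Re p - \<mu>) * x)) has_integral C * (exp (- (Re p - \<mu>) * Y) / (Re p - \<mu>))) {Y..}" for Y
    using p by (intro has_integral_mult_right has_integral_exp_minus_to_infinity) simp
  have ai: "?f absolutely_integrable_on {Y..}" if "0 \<le> Y" for Y
    by (rule measurable_bounded_by_integrable_imp_absolutely_integrable
          [OF continuous_imp_measurable_on_sets_lebesgue[OF contf] _ has_integral_integrable[OF dom]])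
      (use that nf in auto)
  then have int: "?f integrable_on {Y..}" if "0 \<le> Y" for Y
    using that set_lebesgue_integral_eq_integral(1) by blast
  show "?f integrable_on {0..}" by (rule int) simp
  have "(?f has_integral integral {0..X} ?f + integral {X..} ?f) ({0..X} \<union> {X..})"
  proof (rule has_integral_Un)
    show "(?f has_integral integral {0..X} ?f) {0..X}"
      by (intro integrable_integral integrable_continuous_real contf) auto
    show "(?f has_integral integral {X..} ?f) {X..}"
      by (intro integrable_integral int X)
    have "{0..X} \<inter> {X..} \<subseteq> {X}" by auto
    then show "negligible ({0..X} \<inter> {X..})" using negligible_subset by blast
  qed
  moreover have "{0..X} \<union> {X..} = {0..}" using X by auto
  ultimately have "laplace h p = integral {0..X} ?f + integral {X..} ?f"
    by (simp add: laplace_def integral_unique)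
  moreover have "norm (integral {X..} ?f) \<le> integral {X..} (\<lambda>x. C * exp (- (Re p - \<mu>) * x))"
    using X nf by (intro integral_norm_bound_integral int has_integral_integrable[OF dom]) auto
  ultimately show "norm (laplace h p - integral {0..X} ?f) \<le> C * exp (- (Re p - \<mu>) * X) / (Re p - \<mu>)"
    using integral_unique[OF dom] by simp
qed

lemma norm_laplace_le:
  assumes "continuous_on {0..} h" "\<And>x. 0 \<le> x \<Longrightarrow> norm (h x) \<le> C * exp (\<mu> * x)" "\<mu> < Re p"
  shows "norm (laplace h p) \<le> C / (Re p - \<mu>)"
  using laplace_tail(1)[OF assms, of 0] by simp

lemma laplace_tendsto:
  assumes cont: "continuous_on {0..} h" and bound: "\<And>x. 0 \<le> x \<Longrightarrow> norm (h x) \<le> C * exp (\<mu> * x)"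
    and p: "\<mu> < Re p"
  shows "((\<lambda>X. integral {0..X} (\<lambda>x. exp (- p * of_real x) * h x)) \<longlongrightarrow> laplace h p) at_top"
proof -
  have "((\<lambda>X. C * exp (- (Re p - \<mu>) * X) / (Re p - \<mu>)) \<longlongrightarrow> 0) at_top"
    using p by real_asymp
  then have "((\<lambda>X. laplace h p - integral {0..X} (\<lambda>x. exp (- p * of_real x) * h x)) \<longlongrightarrow> 0) at_top"
    by (rule Lim_null_comparison[rotated])
      (use laplace_tail(1)[OF assms] in \<open>auto intro!: eventually_at_top_linorderI[of 0]\<close>)
  then have "((\<lambda>X. laplace h p - (laplace h p - integral {0..X} (\<lambda>x. exp (- p * of_real x) * h x)))
      \<longlongrightarrow> laplace h p - 0) at_top"
    by (intro tendsto_diff tendsto_const)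
  then show ?thesis by simp
qed

lemma holomorphic_on_laplace:
  assumes cont: "continuous_on {0..} h"
    and bound: "\<And>\<mu>. \<mu> > 0 \<Longrightarrow> \<exists>C. \<forall>x\<ge>0. norm (h x) \<le> C * exp (\<mu> * x)"
  shows "laplace h holomorphic_on {p. 0 < Re p}"
proof (rule holomorphic_uniform_sequence)
  show "open {p. 0 < Re p}" by (rule open_halfspace_Re_gt)
  define f where "f n p = integral {0..real n} (\<lambda>x. exp (- p * of_real x) * h x)" for n p
  show "f n holomorphic_on {p. 0 < Re p}" for n
  proof -
    have "(\<lambda>p. integral (cbox 0 (real n)) (\<lambda>x. exp (- p * of_real x) * h x)) holomorphic_on {p. 0 < Re p}"
    proof (rule leibniz_rule_holomorphic)
      show "((\<lambda>p. exp (- p * of_real x) * h x) has_field_derivative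
          - of_real x * (exp (- p * of_real x) * h x)) (at p within {p. 0 < Re p})" for p x
        by (auto intro!: derivative_eq_intros)
      show "(\<lambda>x. exp (- p * of_real x) * h x) integrable_on cbox 0 (real n)" for p
        by (intro integrable_continuous continuous_intros continuous_on_subset[OF cont]) auto
      show "continuous_on ({p. 0 < Re p} \<times> cbox 0 (real n))
          (\<lambda>(p, x). - of_real x * (exp (- p * of_real x) * h x))"
        unfolding case_prod_unfold
        by (intro continuous_intros continuous_on_compose2[OF cont]) auto
      show "convex {p. 0 < Re p}" by (rule convex_halfspace_Re_gt)
    qed
    then show ?thesis by (simp add: f_def[abs_def])
  qed
  fix p0 assume "p0 \<in> {p. 0 < Re p}"
  then have p0: "0 < Re p0" by simp
  \<comment> \<open>On the disc of radius \<open>Re p0 / 2\<close> the real part is at least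
    \<open>2 \<mu>\<close>, so the decay rate \<open>Re p - \<mu>\<close> is at least \<mu>
    uniformly.\<close>
  define \<mu> where "\<mu> = Re p0 / 4"
  have \<mu>: "\<mu> > 0" using p0 by (simp add: \<mu>_def)
  obtain C where C: "\<And>x. x \<ge> 0 \<Longrightarrow> norm (h x) \<le> C * exp (\<mu> * x)"
    using bound[OF \<mu>] by blast
  have "C \<ge> 0" using C[of 0] norm_ge_zero[of "h 0"] by (simp del: norm_ge_zero)
  have Re: "2 * \<mu> \<le> Re p" if "p \<in> cball p0 (Re p0 / 2)" for p
    using that abs_Re_le_cmod[of "p0 - p"] by (auto simp: \<mu>_def dist_norm)
  have "uniform_limit (cball p0 (Re p0 / 2)) f (laplace h) sequentially"
  proof (rule uniform_limitI)
    fix e :: real assume "e > 0"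
    have "((\<lambda>n. C * exp (- \<mu> * real n) / \<mu>) \<longlongrightarrow> 0) sequentially"
      using \<mu> by real_asymp
    then have "\<forall>\<^sub>F n in sequentially. C * exp (- \<mu> * real n) / \<mu> < e"
      using \<open>e > 0\<close> by (auto dest: order_tendstoD(2))
    then show "\<forall>\<^sub>F n in sequentially. \<forall>p\<in>cball p0 (Re p0 / 2). dist (f n p) (laplace h p) < e"
    proof eventually_elim
      case (elim n)
      show ?case
      proof
        fix p assume "p \<in> cball p0 (Re p0 / 2)"
        then have p: "\<mu> \<le> Re p - \<mu>" using Re by fastforce
        have "dist (f n p) (laplace h p) \<le> C * exp (- (Re p - \<mu>) * n) / (Re p - \<mu>)"
          using laplace_tail(1)[OF cont C, of p "real n"] p \<mu>
          by (simp add: f_def dist_norm norm_minus_commute)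
        also have "\<mu> * n \<le> (Re p - \<mu>) * n"
          using p by (intro mult_right_mono) auto
        then have "C * exp (- (Re p - \<mu>) * n) / (Re p - \<mu>) \<le> C * exp (- \<mu> * n) / \<mu>"
          using p \<mu> \<open>C \<ge> 0\<close> by (intro frac_le mult_left_mono) (auto simp: algebra_simps)
        finally show "dist (f n p) (laplace h p) < e" using elim by simp
      qed
    qed
  qed
  moreover have "cball p0 (Re p0 / 2) \<subseteq> {p. 0 < Re p}"
    using Re \<mu> by force
  ultimately show "\<exists>d. 0 < d \<and> cball p0 d \<subseteq> {p. 0 < Re p} \<and> uniform_limit (cball p0 d) f (laplace h) sequentially"
    using p0 by (intro exI[of _ "Re p0 / 2"]) auto
qed

section \<open>Injectivity of the Laplace transform\<close>

lemma continuous_on_log_reparam: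
  fixes w :: "real \<Rightarrow> real"
  assumes cont: "continuous_on {0..} w" and bound: "\<And>x. 0 \<le> x \<Longrightarrow> \<bar>w x\<bar> \<le> C * exp (- x)"
  shows "continuous_on {0..1} (\<lambda>z. if z > 0 then w (- ln z) else 0)" (is "continuous_on _ ?g")
proof -
  have "continuous (at z within {0..1}) ?g" if z: "z \<in> {0..1}" for z
  proof (cases "z = 0")
    case True
    \<comment> \<open>For \<open>x = - ln z\<close> the bound \<open>C exp (- x)\<close> is
      \<open>C z\<close>.\<close>
    have "((\<lambda>z. C * \<bar>z\<bar>) \<longlongrightarrow> 0) (at 0 within {0..1})"
      by (auto intro!: tendsto_eq_intros)
    moreover have "norm (?g z) \<le> C * \<bar>z\<bar>" if "z \<in> {0..1}" for z
      using bound[of "- ln z"] that by (auto simp: ln_le_zero_iff)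
    ultimately have "(?g \<longlongrightarrow> 0) (at 0 within {0..1})"
      by (intro Lim_null_comparison[of ?g "\<lambda>z. C * \<bar>z\<bar>"])
        (simp only: eventually_at_filter, intro always_eventually allI impI)
    then show ?thesis using True by (simp add: continuous_within)
  next
    case False
    then have "z > 0" using z by simp
    have "continuous_on {z / 2..1} (\<lambda>z. w (- ln z))"
      by (rule continuous_on_compose2[OF cont])
        (use \<open>z > 0\<close> in \<open>auto intro!: continuous_intros simp: ln_le_zero_iff\<close>)
    then have "continuous_on {z / 2..1} ?g"
      by (rule continuous_on_eq) (use \<open>z > 0\<close> in auto)
    then have "continuous (at z within {z / 2..1}) ?g"
      using z \<open>z > 0\<close> by (simp add: continuous_on_eq_continuous_within)
    moreover have "at z within {z / 2..1} = at z within {0..1}"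
      by (rule at_within_nhd[of z "{z / 2<..}"]) (use \<open>z > 0\<close> in auto)
    ultimately show ?thesis by simp
  qed
  then show ?thesis by (simp add: continuous_on_eq_continuous_within)
qed

text \<open>In the variable \<open>z = exp (- x)\<close>, \<open>w\<close> extends continuously by \<open>0\<close> to \<open>[0,1]\<close> and is approximated there
  by polynomials, to which it is orthogonal.\<close>

lemma moments_zero_imp_zero:
  fixes w :: "real \<Rightarrow> real"
  assumes cont: "continuous_on {0..} w" and bound: "\<And>x. 0 \<le> x \<Longrightarrow> \<bar>w x\<bar> \<le> C * exp (- x)"
    and moments: "\<And>n. ((\<lambda>x. w x * exp (- x) ^ n) has_integral 0) {0..}"
    and "0 \<le> x"
  shows "w x = 0"
proof -
  have C: "C \<ge> 0" using bound[of 0] by simp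
  have dom: "((\<lambda>x. exp (- x)) has_integral 1) {0::real..}"
    using has_integral_exp_minus_to_infinity[of 1 0] by simp
  have int: "(\<lambda>x. w x * k x) integrable_on {0..}"
    if k: "continuous_on {0..} k" and kb: "\<And>x. x \<ge> 0 \<Longrightarrow> \<bar>k x\<bar> \<le> K" for k K
  proof -
    have "(\<lambda>x. w x * k x) absolutely_integrable_on {0..}"
    proof (rule measurable_bounded_by_integrable_imp_absolutely_integrable
          [OF continuous_imp_measurable_on_sets_lebesgue])
      show "continuous_on {0..} (\<lambda>x. w x * k x)" by (intro continuous_on_mult cont k)
      show "(\<lambda>x. C * K * exp (- x)) integrable_on {0..}"
        by (rule has_integral_integrable[OF has_integral_mult_right[OF dom]])
      fix x :: real assume "x \<in> {0..}"
      then have "\<bar>w x\<bar> * \<bar>k x\<bar> \<le> (C * exp (- x)) * K"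
        using C by (intro mult_mono bound kb) auto
      then show "norm (w x * k x) \<le> C * K * exp (- x)" by (simp add: abs_mult algebra_simps)
    qed auto
    then show ?thesis using set_lebesgue_integral_eq_integral(1) by blast
  qed
  have wb: "\<bar>w x\<bar> \<le> C" if "x \<ge> 0" for x
    using bound[OF that] mult_left_mono[of "exp (- x)" 1 C] C that by simp
  have sq: "(\<lambda>x. w x * w x) integrable_on {0..}" by (rule int[OF cont wb])
  define g where "g z = (if z > 0 then w (- ln z) else 0)" for z :: real
  have gw: "g (exp (- x)) = w x" for x by (simp add: g_def)
  have contg: "continuous_on {0..1} g"
    unfolding g_def by (rule continuous_on_log_reparam[OF cont bound])
  \<comment> \<open>Orthogonality to \<open>P (exp (- x))\<close> replaces one factor of the square
    by the approximation error, which is below \<open>e\<close>; the other factor is integrable with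
    norm at most \<open>C\<close>.\<close>
  have le: "integral {0..} (\<lambda>x. w x * w x) \<le> e * C" if "e > 0" for e
  proof -
    obtain P where P: "real_polynomial_function P" "\<And>z. z \<in> {0..1} \<Longrightarrow> \<bar>g z - P z\<bar> < e"
      using Stone_Weierstrass_real_polynomial_function[OF compact_Icc contg \<open>e > 0\<close>] by blast
    obtain a n where a: "P = (\<lambda>z. \<Sum>i\<le>n. a i * z ^ i)"
      using P(1) by (auto simp: real_polynomial_function_iff_sum)
    have "((\<lambda>x. \<Sum>i\<le>n. a i * (w x * exp (- x) ^ i)) has_integral (\<Sum>i\<le>n. a i * 0)) {0..}"
      by (intro has_integral_sum has_integral_mult_right moments) auto
    then have "((\<lambda>x. w x * P (exp (- x))) has_integral 0) {0..}"
      by (simp add: a sum_distrib_left algebra_simps)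
    from has_integral_diff[OF integrable_integral[OF sq] this]
    have I: "((\<lambda>x. w x * (w x - P (exp (- x)))) has_integral integral {0..} (\<lambda>x. w x * w x)) {0..}"
      by (simp add: right_diff_distrib)
    have "((\<lambda>x. e * C * exp (- x)) has_integral e * C * 1) {0..}"
      by (intro has_integral_mult_right dom)
    with I have "integral {0..} (\<lambda>x. w x * w x) \<le> e * C * 1"
    proof (rule has_integral_le)
      fix x :: real assume x: "x \<in> {0..}"
      then have "\<bar>w x\<bar> * \<bar>w x - P (exp (- x))\<bar> \<le> (C * exp (- x)) * e"
        using C P(2)[of "exp (- x)"] gw[of x] by (intro mult_mono bound) auto
      then show "w x * (w x - P (exp (- x))) \<le> e * C * exp (- x)"
        unfolding abs_mult[symmetric] by (simp add: algebra_simps)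
    qed
    then show ?thesis by simp
  qed
  have "integral {0..} (\<lambda>x. w x * w x) \<le> 0"
  proof (rule field_le_epsilon)
    fix e :: real assume "e > 0"
    \<comment> \<open>The summand 1 covers \<open>C = 0\<close>.\<close>
    have "integral {0..} (\<lambda>x. w x * w x) \<le> e / (C + 1) * C"
      using \<open>e > 0\<close> C by (intro le) auto
    also have "\<dots> \<le> e" using \<open>e > 0\<close> C by (simp add: field_simps)
    finally show "integral {0..} (\<lambda>x. w x * w x) \<le> 0 + e" by simp
  qed
  \<comment> \<open>The interval reaches to \<open>x + 1\<close> so that it is nondegenerate also
    for \<open>x = 0\<close>.\<close>
  moreover have "continuous_on {0..x + 1} (\<lambda>x. w x * w x)"
    by (intro continuous_on_mult continuous_on_subset[OF cont]) auto
  moreover from this have "integral {0..x + 1} (\<lambda>x. w x * w x) \<le> integral {0..} (\<lambda>x. w x * w x)"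
    by (intro integral_subset_le sq integrable_continuous_real) auto
  moreover have "0 \<le> integral {0..x + 1} (\<lambda>x. w x * w x)"
    by (intro integral_nonneg integrable_continuous_real) (use calculation in auto)
  ultimately show ?thesis
    using integral_eq_0_iff[of 0 "x + 1" "\<lambda>x. w x * w x"] \<open>0 \<le> x\<close> by auto
qed

text \<open>After damping by \<open>exp (- (\<mu> + 1) x)\<close>, the moments in
  \<open>exp (- x)\<close> are the values of the transform at the points
  \<open>\<mu> + 1 + n\<close>, all to the right of \<mu>. Real and imaginary parts are separated
  because the moment argument is for real functions.\<close>

lemma laplace_zero_imp_zero:
  assumes cont: "continuous_on {0..} h" and bound: "\<And>x. 0 \<le> x \<Longrightarrow> norm (h x) \<le> C * exp (\<mu> * x)"
    and zero: "\<And>r. \<mu> < r \<Longrightarrow> laplace h (of_real r) = 0" and "0 \<le> x"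
  shows "h x = 0"
proof -
  define w where "w x = exp (- (\<mu> + 1) * x) *\<^sub>R h x" for x
  have contw: "continuous_on {0..} w"
    unfolding w_def by (intro continuous_intros cont)
  have wb: "norm (w x) \<le> C * exp (- x)" if "0 \<le> x" for x
  proof -
    have "norm (w x) \<le> exp (- (\<mu> + 1) * x) * (C * exp (\<mu> * x))"
      using bound[OF that] by (simp add: w_def)
    also have "\<dots> = C * exp (- x)" by (simp add: algebra_simps flip: exp_add)
    finally show ?thesis .
  qed
  have moments: "((\<lambda>x. exp (- x) ^ n *\<^sub>R w x) has_integral 0) {0..}" for n
  proof -
    have "exp (- complex_of_real (\<mu> + 1 + n) * of_real x) * h x = exp (- x) ^ n *\<^sub>R w x" for x
    proof -
      have "exp (- complex_of_real (\<mu> + 1 + n) * of_real x) = of_real (exp (- (\<mu> + 1 + n) * x))"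
        by (simp flip: exp_of_real)
      also have "- (\<mu> + 1 + n) * x = n * (- x) + - (\<mu> + 1) * x" by (simp add: algebra_simps)
      finally show ?thesis
        unfolding exp_add exp_of_nat_mult by (simp add: w_def scaleR_conv_of_real)
    qed
    moreover have "((\<lambda>x. exp (- complex_of_real (\<mu> + 1 + n) * of_real x) * h x) has_integral 0) {0..}"
      using laplace_tail(2)[OF cont bound, of "of_real (\<mu> + 1 + n)" 0]
        zero[of "\<mu> + 1 + n"] by (auto simp: laplace_def has_integral_iff)
    ultimately show ?thesis by simp
  qed
  have "Re (w x) = 0"
  proof (rule moments_zero_imp_zero[of "\<lambda>x. Re (w x)"])
    show "continuous_on {0..} (\<lambda>x. Re (w x))" by (intro continuous_intros contw)
    show "\<bar>Re (w x)\<bar> \<le> C * exp (- x)" if "0 \<le> x" for x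
      using wb[OF that] abs_Re_le_cmod order_trans by blast
    show "((\<lambda>x. Re (w x) * exp (- x) ^ n) has_integral 0) {0..}" for n
      using has_integral_linear[OF moments bounded_linear_Re, of n] by (simp add: o_def mult.commute)
  qed fact
  moreover have "Im (w x) = 0"
  proof (rule moments_zero_imp_zero[of "\<lambda>x. Im (w x)"])
    show "continuous_on {0..} (\<lambda>x. Im (w x))" by (intro continuous_intros contw)
    show "\<bar>Im (w x)\<bar> \<le> C * exp (- x)" if "0 \<le> x" for x
      using wb[OF that] abs_Im_le_cmod order_trans by blast
    show "((\<lambda>x. Im (w x) * exp (- x) ^ n) has_integral 0) {0..}" for n
      using has_integral_linear[OF moments bounded_linear_Im, of n] by (simp add: o_def mult.commute)
  qed fact
  ultimately have "w x = 0" by (simp add: complex_eq_iff)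
  then show ?thesis by (simp add: w_def)
qed

section \<open>Decay in a half-plane\<close>

text \<open>Division by \<open>1 + e z\<close> makes the bounded function decay at infinity while
  not enlarging it on the line, so the maximum principle applies on a large truncated region; then
  \<open>e\<close> tends to 0. The size of \<open>B\<close> does not enter the conclusion.\<close>

lemma Phragmen_Lindelof_bounded:
  assumes hol: "f holomorphic_on {z. 0 < Re z}"
    and bounded: "\<And>z. 1 \<le> Re z \<Longrightarrow> norm (f z) \<le> B"
    and line: "\<And>z. Re z = 1 \<Longrightarrow> norm (f z) \<le> M" and "0 < M" and s: "1 \<le> Re s"
  shows "norm (f s) \<le> M"
proof -
  have "B \<ge> 0" using bounded[of 1] norm_ge_zero[of "f 1"] by (simp del: norm_ge_zero)
  have eps: "norm (f s) \<le> M * norm (1 + of_real e * s)" if "e > 0" for e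
  proof -
    define g where "g z = f z / (1 + of_real e * z)" for z
    have re: "1 \<le> Re (1 + of_real e * z)" if "0 \<le> Re z" for z using that \<open>e > 0\<close> by simp
    then have denom: "1 \<le> norm (1 + of_real e * z)" if "0 \<le> Re z" for z
      using that complex_Re_le_cmod order_trans by blast
    have denom2: "e * norm z \<le> norm (1 + of_real e * z)" if "0 \<le> Re z" for z
    proof -
      have "(e * norm z)\<^sup>2 \<le> (norm (1 + of_real e * z))\<^sup>2"
        using that \<open>e > 0\<close> unfolding power_mult_distrib cmod_power2
        by (simp add: power2_eq_square algebra_simps)
      then show ?thesis by (rule power2_le_imp_le) simp
    qed
    \<comment> \<open>The first entry puts \<open>s\<close> into \<open>S\<close>; the second gives
      \<open>B <= e M R\<close>, so the quotient is at most \<open>M\<close> on the arc.\<close>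
    define R where "R = max (norm s) (B / (e * M))"
    define S where "S = {z. 1 \<le> Re z} \<inter> cball 0 R"
    have "closed S" unfolding S_def by (intro closed_Int closed_halfspace_Re_ge closed_cball)
    have "bounded S" unfolding S_def by (simp add: bounded_Int)
    have holg: "g holomorphic_on {z. 0 < Re z}"
      unfolding g_def
    proof (rule holomorphic_on_divide[OF hol])
      show "(\<lambda>z. 1 + of_real e * z) holomorphic_on {z. 0 < Re z}"
        by (intro holomorphic_intros)
      show "1 + of_real e * z \<noteq> 0" if "z \<in> {z. 0 < Re z}" for z
      proof
        assume "1 + of_real e * z = 0"
        with denom[of z] that show False by simp
      qed
    qed
    have "S \<subseteq> {z. 0 < Re z}" by (auto simp: S_def)
    have "norm (g s) \<le> M"
    proof (rule maximum_modulus_frontier[where f = g and S = S])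
      show "g holomorphic_on interior S"
        using holomorphic_on_subset[OF holg] interior_subset[of S] \<open>S \<subseteq> {z. 0 < Re z}\<close> by blast
      show "continuous_on (closure S) g"
        using holomorphic_on_imp_continuous_on[OF holg] \<open>closed S\<close> \<open>S \<subseteq> {z. 0 < Re z}\<close>
          continuous_on_subset by auto
      show "bounded S" by fact
      show "s \<in> S" using s by (simp add: S_def R_def)
      fix z assume z: "z \<in> frontier S"
      have "{z. 1 < Re z} \<inter> ball 0 R \<subseteq> interior S"
        by (intro interior_maximal open_Int open_halfspace_Re_gt open_ball) (auto simp: S_def)
      then have "z \<in> S" "\<not> (1 < Re z \<and> norm z < R)"
        using z \<open>closed S\<close> by (auto simp: frontier_def)
      then consider "Re z = 1" | "1 \<le> Re z" "norm z = R" by (force simp: S_def)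
      then show "norm (g z) \<le> M"
      proof cases
        case 1
        have "norm (f z) \<le> M * 1" using line[OF 1] by simp
        also have "\<dots> \<le> M * norm (1 + of_real e * z)"
          using denom[of z] 1 \<open>0 < M\<close> by (intro mult_left_mono) auto
        finally show ?thesis
          using denom[of z] 1 \<open>0 < M\<close> by (simp add: g_def norm_divide divide_le_eq)
      next
        case 2
        have "B \<le> M * (e * norm z)"
          using 2 \<open>e > 0\<close> \<open>0 < M\<close> unfolding R_def by (simp add: field_simps max_def split: if_splits)
        also have "\<dots> \<le> M * norm (1 + of_real e * z)"
          using denom2[of z] 2 \<open>0 < M\<close> by (intro mult_left_mono) auto
        finally show ?thesis
          using bounded[of z] denom[of z] 2 \<open>0 < M\<close> by (simp add: g_def norm_divide divide_le_eq)
      qed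
    qed
    moreover have "0 < norm (1 + of_real e * s)" by (rule less_le_trans[OF zero_less_one denom]) (use s in simp)
    ultimately show ?thesis by (simp add: g_def norm_divide pos_divide_le_eq)
  qed
  have "((\<lambda>e. M * norm (1 + of_real e * s)) \<longlongrightarrow> M * norm (1 + of_real 0 * s)) (at_right 0)"
    by (intro tendsto_intros)
  then have "((\<lambda>e. M * norm (1 + of_real e * s)) \<longlongrightarrow> M) (at_right 0)" by simp
  then show ?thesis
    by (rule tendsto_lowerbound) (use eps in \<open>auto simp: eventually_at_filter intro!: always_eventually\<close>)
qed

text \<open>The factor \<open>exp (T (z - 1))\<close> has modulus 1 on the line
  \<open>Re z = 1\<close>, so the bound \<open>M\<close> there does not depend on \<open>T\<close>.
  The constant belonging to \<open>T\<close> only supplies the boundedness that the maximum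
  principle asks for.\<close>

lemma superexponential_decay_imp_zero:
  assumes hol: "k holomorphic_on {z. 0 < Re z}"
    and unbounded: "\<And>M. \<exists>T\<in>\<T>. M < T"
    and decay: "\<And>T. T \<in> \<T> \<Longrightarrow> \<exists>C. \<forall>s. 1 \<le> Re s \<longrightarrow> norm (k s) \<le> C * exp (- T * Re s)"
    and s: "1 < Re s"
  shows "k s = 0"
proof (rule ccontr)
  assume "k s \<noteq> 0"
  obtain T0 C0 where C0: "\<And>s. 1 \<le> Re s \<Longrightarrow> norm (k s) \<le> C0 * exp (- T0 * Re s)"
    using unbounded decay by meson
  define M where "M = \<bar>C0\<bar> * exp (- T0) + 1"
  have M: "M > 0" by (simp add: M_def add_nonneg_pos)
  have line: "norm (k z) \<le> M" if "Re z = 1" for z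
  proof -
    have "norm (k z) \<le> C0 * exp (- T0)" using C0[of z] that by simp
    also have "\<dots> \<le> \<bar>C0\<bar> * exp (- T0)" by (intro mult_right_mono) auto
    finally show ?thesis by (simp add: M_def)
  qed
  \<comment> \<open>For such \<open>T\<close>, \<open>exp (T (Re s - 1))\<close> exceeds
    \<open>M / norm (k s)\<close>, contradicting the estimate to come; this uses
    \<open>Re s > 1\<close>.\<close>
  obtain T where T: "T \<in> \<T>" "ln (M / norm (k s)) / (Re s - 1) < T"
    using unbounded by blast
  obtain C where C: "\<And>s. 1 \<le> Re s \<Longrightarrow> norm (k s) \<le> C * exp (- T * Re s)"
    using decay[OF T(1)] by blast
  have "norm (k s * exp (of_real T * (s - 1))) \<le> M"
  proof (rule Phragmen_Lindelof_bounded[where f = "\<lambda>z. k z * exp (of_real T * (z - 1))"])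
    show "(\<lambda>z. k z * exp (of_real T * (z - 1))) holomorphic_on {z. 0 < Re z}"
      by (intro holomorphic_intros hol)
    show "norm (k z * exp (of_real T * (z - 1))) \<le> C * exp (- T)" if "1 \<le> Re z" for z
    proof -
      have "norm (k z) * exp (T * (Re z - 1)) \<le> C * exp (- T * Re z) * exp (T * (Re z - 1))"
        by (intro mult_right_mono C that) simp
      also have "\<dots> = C * exp (- T)" by (simp add: algebra_simps flip: exp_add)
      finally show ?thesis by (simp add: norm_mult)
    qed
    show "norm (k z * exp (of_real T * (z - 1))) \<le> M" if "Re z = 1" for z
      using line[OF that] that by (simp add: norm_mult)
  qed (use M s in auto)
  then have "exp (T * (Re s - 1)) \<le> M / norm (k s)"
    using \<open>k s \<noteq> 0\<close> by (simp add: norm_mult field_simps)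
  moreover have "exp (ln (M / norm (k s))) < exp (T * (Re s - 1))"
    using T(2) s by (simp add: pos_divide_less_eq)
  ultimately show False using M \<open>k s \<noteq> 0\<close> by simp
qed

section \<open>Laplace transforms of data of exponential order below 1\<close>

text \<open>The additive constant is independent of \<open>x\<close>; where \<open>\<theta> x\<^sup>q\<close> exceeds \<open>\<sigma> x / 2\<close>, \<open>x\<close> is at most
  \<open>(2 \<theta> / \<sigma>)\<^sup>1\<^sup>/\<^sup>(\<^sup>1\<^sup>-\<^sup>q\<^sup>)\<close>.\<close>

lemma powr_le_linear:
  fixes \<theta> q \<sigma> x :: real
  assumes "0 < \<theta>" "0 < q" "q < 1" "0 < \<sigma>" "0 \<le> x"
  defines "a \<equiv> q / (1 - q)"
  shows "\<theta> * x powr q \<le> \<sigma> / 2 * x + \<theta> * (2 * \<theta>) powr a * \<sigma> powr (- a)"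
proof (cases "\<theta> * x powr q \<le> \<sigma> / 2 * x")
  case True
  have "0 \<le> \<theta> * (2 * \<theta>) powr a * \<sigma> powr (- a)" using assms by simp
  with True show ?thesis by linarith
next
  case False
  then have "x \<noteq> 0" by auto
  then have x: "x > 0" using assms by simp
  have "x powr q * (\<sigma> * x powr (1 - q)) = \<sigma> * (x powr q * x powr (1 - q))" by simp
  also have "\<dots> = \<sigma> * x" using x by (simp flip: powr_add)
  also have "\<dots> \<le> x powr q * (2 * \<theta>)" using False by (simp add: algebra_simps)
  finally have "\<sigma> * x powr (1 - q) \<le> 2 * \<theta>" using x by simp
  then have "x powr (1 - q) \<le> 2 * \<theta> / \<sigma>"
    using \<open>0 < \<sigma>\<close> by (simp add: pos_le_divide_eq mult.commute)
  then have "(x powr (1 - q)) powr a \<le> (2 * \<theta> / \<sigma>) powr a"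
    using assms by (intro powr_mono2) auto
  also have "(x powr (1 - q)) powr a = x powr q"
    using assms by (simp add: powr_powr a_def)
  also have "(2 * \<theta> / \<sigma>) powr a = (2 * \<theta>) powr a * \<sigma> powr (- a)"
    using assms(1,4) by (simp add: powr_divide powr_minus_divide)
  finally have "\<theta> * x powr q \<le> \<theta> * ((2 * \<theta>) powr a * \<sigma> powr (- a))"
    using assms by (intro mult_left_mono) auto
  moreover have "0 \<le> \<sigma> / 2 * x" using assms by simp
  ultimately show ?thesis by (simp only: mult.assoc)
qed

text \<open>This is \<open>ln y <= y - 1\<close> at \<open>y = \<sigma> powr (- a)\<close>. It
  absorbs the factor \<open>1 / Re p\<close> of the Laplace integral into an exponential of the same
  power.\<close>

lemma inverse_le_exp_powr:
  fixes \<sigma> a :: real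
  assumes "0 < \<sigma>" "0 < a"
  shows "1 / \<sigma> \<le> exp (\<sigma> powr (- a) / a)"
proof -
  have "ln (\<sigma> powr (- a)) \<le> \<sigma> powr (- a)"
    using assms ln_le_minus_one[of "\<sigma> powr (- a)"] by simp
  then have "- ln \<sigma> \<le> \<sigma> powr (- a) / a"
    using assms by (simp add: ln_powr pos_le_divide_eq mult.commute)
  then have "exp (- ln \<sigma>) \<le> exp (\<sigma> powr (- a) / a)" by simp
  then show ?thesis using assms by (simp add: exp_minus inverse_eq_divide)
qed

text \<open>Half of the decay rate \<open>Re p\<close> is spent on the growth of \<open>h\<close>;
  the other half makes the integral converge and produces the factor 2. The coefficient in the
  exponent depends on \<theta> and \<open>q\<close> only, not on \<open>h\<close>.\<close>

lemma norm_laplace_le_exp_powr: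
  fixes \<theta> q :: real
  assumes \<theta>: "0 < \<theta>" and q: "0 < q" "q < 1"
  defines "a \<equiv> q / (1 - q)"
  assumes cont: "continuous_on {0..} h"
    and bound: "\<And>x. 0 \<le> x \<Longrightarrow> norm (h x) \<le> C * exp (\<theta> * x powr q)" and p: "0 < Re p"
  shows "norm (laplace h p) \<le> 2 * C * exp ((\<theta> * (2 * \<theta>) powr a + 1 / a) * Re p powr (- a))"
proof -
  define E where "E = \<theta> * (2 * \<theta>) powr a * Re p powr (- a)"
  have a: "a > 0" using q by (simp add: a_def)
  have "C \<ge> 0" using bound[of 0] norm_ge_zero[of "h 0"] q by (simp del: norm_ge_zero)
  have "norm (laplace h p) \<le> (C * exp E) / (Re p - Re p / 2)"
  proof (rule norm_laplace_le[OF cont])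
    fix x :: real assume x: "0 \<le> x"
    have "exp (\<theta> * x powr q) \<le> exp (E + Re p / 2 * x)"
      using powr_le_linear[OF \<theta> q p x] unfolding a_def[symmetric] E_def by simp
    then have "C * exp (\<theta> * x powr q) \<le> C * exp (E + Re p / 2 * x)"
      using \<open>C \<ge> 0\<close> by (rule mult_left_mono)
    with bound[OF x] show "norm (h x) \<le> C * exp E * exp (Re p / 2 * x)"
      by (simp add: exp_add)
  qed (use p in auto)
  also have "\<dots> = 2 * C * exp E * (1 / Re p)" by (simp add: field_simps)
  also have "\<dots> \<le> 2 * C * exp E * exp (Re p powr (- a) / a)"
    using \<open>C \<ge> 0\<close> by (intro mult_left_mono inverse_le_exp_powr p a) auto
  also have "\<dots> = 2 * C * exp (E + Re p powr (- a) / a)" by (simp add: exp_add)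
  also have "E + Re p powr (- a) / a = (\<theta> * (2 * \<theta>) powr a + 1 / a) * Re p powr (- a)"
    by (simp add: E_def distrib_right)
  finally show ?thesis .
qed

text \<open>The argument of \<open>s\<close> is below \<open>pi/2\<close> in modulus, so that of its
  power is below \<open>g pi/2\<close>, where the cosine is still positive.\<close>

lemma Re_powr_of_real_ge:
  assumes s: "0 < Re s" and g: "0 < g" "g < 1"
  shows "cos (g * (pi / 2)) * norm s powr g \<le> Re (s powr of_real g)"
    and "0 < cos (g * (pi / 2))"
proof -
  show "0 < cos (g * (pi / 2))"
    using g by (intro cos_gt_zero_pi) (auto simp: mult_less_cancel_right_disj intro: less_trans[of _ 0])
  have "s \<noteq> 0" using s by auto
  have Im: "\<bar>Im (Ln s)\<bar> < pi / 2" using Re_Ln_pos_lt[OF \<open>s \<noteq> 0\<close>] s by simp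
  have "cos (g * (pi / 2)) \<le> cos \<bar>g * Im (Ln s)\<bar>"
  proof (rule cos_monotone_0_pi_le)
    show "\<bar>g * Im (Ln s)\<bar> \<le> g * (pi / 2)"
      using Im g by (simp add: abs_mult)
    have "g * (pi / 2) \<le> 1 * (pi / 2)" using g by (intro mult_right_mono) auto
    then show "g * (pi / 2) \<le> pi" by simp
  qed simp
  then have "cos (g * (pi / 2)) \<le> cos (g * Im (Ln s))" by simp
  then have "cos (g * (pi / 2)) * exp (g * ln (norm s)) \<le> cos (g * Im (Ln s)) * exp (g * ln (norm s))"
    by (rule mult_right_mono) simp
  moreover have "Re (s powr of_real g) = cos (g * Im (Ln s)) * exp (g * ln (norm s))"
    using \<open>s \<noteq> 0\<close> by (simp add: powr_def Re_exp mult.commute)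
  ultimately show "cos (g * (pi / 2)) * norm s powr g \<le> Re (s powr of_real g)"
    using \<open>s \<noteq> 0\<close> by (simp add: powr_def)
qed

lemma Re_one_divide: "Re (1 / w) = Re w / (norm w)\<^sup>2"
  by (simp add: Re_divide cmod_power2)

text \<open>Since \<open>Re (s + s\<^sup>g)\<close> is at least of order \<open>|s|\<^sup>g\<close> and \<open>|s + s\<^sup>g| \<le> 2 |s|\<close>, the substitution \<open>1/p = s + s\<^sup>g\<close> turns
  \<open>(Re p)\<^sup>-\<^sup>a\<close> into \<open>O(|s|\<^sup>a\<^sup>(\<^sup>2\<^sup>-\<^sup>g\<^sup>))\<close>. The choice of \<open>g\<close> makes this exponent less than \<open>1\<close>.\<close>

lemma half_plane_uniqueness:
  assumes hol: "F holomorphic_on {p. 0 < Re p}"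
    and a: "0 < a" "a < 1" and c: "0 \<le> c"
    and unbounded: "\<And>M. \<exists>T\<in>\<T>. M < T" and nonneg: "\<And>T. T \<in> \<T> \<Longrightarrow> 0 \<le> T"
    and bound: "\<And>T. T \<in> \<T> \<Longrightarrow> \<exists>C. \<forall>p. 0 < Re p \<longrightarrow>
       norm (F p) \<le> C * exp (- T * Re (1 / p) + c * Re p powr (- a))"
    and p: "0 < Re p"
  shows "F p = 0"
proof -
  \<comment> \<open>With this choice \<open>b = a (3 - a) / 2\<close>, and \<open>b < 1\<close>
    amounts to \<open>(1 - a) (2 - a) > 0\<close>.\<close>
  define g where "g = (1 + a) / 2"
  define b where "b = a * (2 - g)"
  have g: "0 < g" "g < 1" using a by (auto simp: g_def)
  have "0 < (1 - a) * (2 - a)" using a by simp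
  then have b: "0 < b" "b < 1" using a g by (auto simp: b_def g_def field_simps)
  define \<kappa> where "\<kappa> = cos (g * (pi / 2))"
  define \<kappa>' where "\<kappa>' = cos (b * (pi / 2))"
  have \<kappa>: "0 < \<kappa>" "0 < \<kappa>'" using Re_powr_of_real_ge(2)[of 1] g b by (auto simp: \<kappa>_def \<kappa>'_def)
  define W where "W s = s + s powr of_real g" for s :: complex
  have ReW: "Re s + \<kappa> * norm s powr g \<le> Re (W s)" if "0 < Re s" for s
    using Re_powr_of_real_ge(1)[OF that g] by (simp add: W_def \<kappa>_def)
  \<comment> \<open>Together with \<open>T >= 0\<close> this passes the decay in
    \<open>Re (W s)\<close> on to \<open>Re s\<close>.\<close>
  have ReW_ge: "Re s \<le> Re (W s)" if "0 < Re s" for s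
    using ReW[OF that] \<kappa> by (smt (verit) mult_nonneg_nonneg powr_ge_zero)
  have W0: "W s \<noteq> 0" if "0 < Re s" for s using ReW_ge[OF that] that by auto
  have ReW': "0 < Re (1 / W s)" if "0 < Re s" for s
    using ReW_ge[OF that] that W0[OF that] by (simp only: Re_one_divide) simp
  \<comment> \<open>The 4 comes from \<open>|W s| <= 2 |s|\<close> squared, the \<kappa> from
    \<open>Re (W s) >= \<kappa> |s|^g\<close>.\<close>
  define D where "D = c * (4 / \<kappa>) powr a"
  have D: "D \<ge> 0" using c by (simp add: D_def)
  have key: "c * Re (1 / W s) powr (- a) \<le> D * norm s powr b" if s: "1 \<le> Re s" for s
  proof -
    have s0: "0 < Re s" using s by simp
    have ns: "1 \<le> norm s" using s complex_Re_le_cmod[of s] by linarith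
    have "norm (s powr of_real g) = norm s powr g"
      using norm_powr_real_powr'[of "of_real g" s] by simp
    also have "\<dots> \<le> norm s powr 1" using ns g by (intro powr_mono) auto
    finally have "norm (W s) \<le> 2 * norm s"
      using norm_triangle_ineq[of s "s powr of_real g"] ns by (simp add: W_def)
    then have nW: "(norm (W s))\<^sup>2 \<le> (2 * norm s)\<^sup>2" by (rule power_mono) simp
    have pos: "0 < \<kappa> * norm s powr g" using \<kappa> s by (intro mult_pos_pos) auto
    have le: "\<kappa> * norm s powr g \<le> Re (W s)" using ReW[OF s0] s0 by linarith
    have "inverse (Re (1 / W s)) = (norm (W s))\<^sup>2 / Re (W s)"
      by (simp only: Re_one_divide inverse_divide)
    also have "\<dots> \<le> (2 * norm s)\<^sup>2 / (\<kappa> * norm s powr g)"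
      using nW pos le by (intro frac_le) auto
    also have "\<dots> = 4 / \<kappa> * norm s powr (2 - g)"
      using ns by (simp add: powr_diff power_mult_distrib powr_numeral divide_simps)
    finally have inv: "inverse (Re (1 / W s)) \<le> 4 / \<kappa> * norm s powr (2 - g)" .
    have "y powr (- a) = inverse y powr a" if "0 < y" for y
      using that by (simp add: powr_def ln_inverse)
    from this[OF ReW'[OF s0]] have "Re (1 / W s) powr (- a) = inverse (Re (1 / W s)) powr a" .
    also have "\<dots> \<le> (4 / \<kappa> * norm s powr (2 - g)) powr a"
      using inv a ReW'[OF s0] by (intro powr_mono2) auto
    also have "\<dots> = (4 / \<kappa>) powr a * norm s powr b"
      using \<kappa> powr_mult[of "4 / \<kappa>" "norm s powr (2 - g)" a] by (simp add: powr_powr b_def mult.commute)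
    finally show ?thesis using c by (simp add: D_def mult.assoc mult_left_mono)
  qed
  \<comment> \<open>The added factor has modulus at most \<open>exp (- D |s|^b)\<close>, which
    cancels the growth found in \<open>key\<close>. It does not depend on \<open>T\<close>, so the
    same \<open>k\<close> has every decay rate.\<close>
  define k where "k s = F (1 / W s) * exp (- of_real (D / \<kappa>') * s powr of_real b)" for s
  have k0: "k s = 0" if s: "1 < Re s" for s
  proof (rule superexponential_decay_imp_zero[OF _ unbounded _ s])
    have nonpos: "s \<notin> \<real>\<^sub>\<le>\<^sub>0" if "0 < Re s" for s
      using that by (auto simp: complex_nonpos_Reals_iff)
    have "(\<lambda>s. 1 / W s) holomorphic_on {s. 0 < Re s}"
      unfolding W_def using W0[unfolded W_def] nonpos
      by (intro holomorphic_intros) auto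
    then have "(F \<circ> (\<lambda>s. 1 / W s)) holomorphic_on {s. 0 < Re s}"
      using ReW' by (intro holomorphic_on_compose_gen[OF _ hol]) auto
    then show "k holomorphic_on {s. 0 < Re s}"
      unfolding k_def[abs_def] o_def using nonpos by (intro holomorphic_intros) auto
    fix T assume T: "T \<in> \<T>"
    obtain C where C: "\<And>p. 0 < Re p \<Longrightarrow> norm (F p) \<le> C * exp (- T * Re (1 / p) + c * Re p powr (- a))"
      using bound[OF T] by blast
    have "C \<ge> 0"
      using C[of 1] norm_ge_zero[of "F 1"] by (simp add: zero_le_mult_iff del: norm_ge_zero)
        (metis exp_gt_zero norm_ge_zero order_trans zero_le_mult_iff not_le)
    show "\<exists>C. \<forall>s. 1 \<le> Re s \<longrightarrow> norm (k s) \<le> C * exp (- T * Re s)"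
    proof (intro exI allI impI)
      fix s :: complex assume s: "1 \<le> Re s"
      then have s0: "0 < Re s" by simp
      have "norm (F (1 / W s)) \<le> C * exp (- T * Re (W s) + c * Re (1 / W s) powr (- a))"
        using C[OF ReW'[OF s0]] by simp
      also have "\<dots> \<le> C * exp (- T * Re s + D * norm s powr b)"
        using key[OF s] mult_left_mono[OF ReW_ge[OF s0] nonneg[OF T]] \<open>C \<ge> 0\<close>
        by (intro mult_left_mono) auto
      finally have 1: "norm (F (1 / W s)) \<le> C * exp (- T * Re s + D * norm s powr b)" .
      have "D / \<kappa>' * (\<kappa>' * norm s powr b) \<le> D / \<kappa>' * Re (s powr of_real b)"
        using Re_powr_of_real_ge(1)[OF s0 b] \<kappa> D by (intro mult_left_mono) (auto simp: \<kappa>'_def)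
      then have 2: "norm (exp (- of_real (D / \<kappa>') * s powr of_real b)) \<le> exp (- (D * norm s powr b))"
        using \<kappa> by (simp add: divide_simps mult.commute)
      have "norm (k s) \<le> C * exp (- T * Re s + D * norm s powr b) * exp (- (D * norm s powr b))"
        unfolding k_def norm_mult using 1 2 \<open>C \<ge> 0\<close> by (intro mult_mono) auto
      also have "\<dots> = C * exp (- T * Re s)" by (simp flip: exp_add)
      finally show "norm (k s) \<le> C * exp (- T * Re s)" .
    qed
  qed
  \<comment> \<open>Real \<open>t > 1\<close> correspond to \<open>1/r = t + t^g > 2\<close>, hence
    the range of \<open>r\<close>. Such a segment suffices for the identity theorem on the
    half-plane.\<close>
  have F0: "F (of_real r) = 0" if r: "r \<in> {0<..<1/2}" for r
  proof -
    have r2: "2 < 1 / r" using r by (simp add: field_simps)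
    have "\<exists>t\<ge>1. t \<le> 1 / r \<and> t + t powr g = 1 / r"
      using r2 by (intro IVT') (auto intro!: continuous_intros)
    then obtain t where t: "1 \<le> t" "t + t powr g = 1 / r" by blast
    have "t \<noteq> 1" using t(2) r2 by auto
    then have "k (of_real t) = 0" using t by (intro k0) simp
    then have "F (1 / W (of_real t)) = 0" by (simp add: k_def)
    moreover have "W (of_real t) = of_real (t + t powr g)"
      using t(1) by (simp add: W_def powr_of_real)
    then have "1 / W (of_real t) = of_real r"
      unfolding t(2) using r by simp
    ultimately show ?thesis by simp
  qed
  show ?thesis
  proof (rule analytic_continuation[OF hol])
    show "open {p. 0 < Re p}" by (rule open_halfspace_Re_gt)
    show "connected {p. 0 < Re p}" by (intro convex_connected convex_halfspace_Re_gt)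
    show "of_real ` {0<..<1/2} \<subseteq> {p. 0 < Re p}" by auto
    show "of_real (1/4) \<in> {p. 0 < Re p}" by simp
    have "(\<lambda>n. 1 / 4 + 1 / (real n + 8)) \<longlonglongrightarrow> 1 / 4" by real_asymp
    then have "(\<lambda>n. complex_of_real (1 / 4 + 1 / (real n + 8))) \<longlonglongrightarrow> of_real (1 / 4)"
      by (rule tendsto_of_real)
    moreover have "1 / 4 + 1 / (real n + 8) \<in> {0<..<1/2} - {1/4}" for n
      by (auto simp: field_simps add_pos_nonneg)
    then have "complex_of_real (1 / 4 + 1 / (real n + 8)) \<in> complex_of_real ` {0<..<1/2} - {of_real (1/4)}" for n
      by (simp only: Diff_iff singleton_iff of_real_eq_iff image_iff) blast
    ultimately show "of_real (1/4) islimpt (complex_of_real ` {0<..<1/2})"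
      unfolding islimpt_sequential by (intro exI conjI allI)
  qed (use F0 p in auto)
qed

section \<open>Uniqueness\<close>

lemma integral_reflect_Icc:
  fixes f :: "real \<Rightarrow> 'a::euclidean_space"
  shows "integral {T - t..T - s} f = integral {s..t} (\<lambda>\<tau>. f (T - \<tau>))"
proof -
  have "integral {s..t} (\<lambda>\<tau>. f (T - \<tau>)) = integral {- t..- s} (\<lambda>\<tau>. f (T + \<tau>))"
    using Henstock_Kurzweil_Integration.integral_reflect_real[of t s "\<lambda>\<tau>. f (T - \<tau>)"] by simp
  then show ?thesis
    using integral_shift_Icc_real[of "- t" "- s" f T] by (simp add: o_def)
qed

text \<open>Reversing time changes the sign of the double integral. Stating the equation for norms
  lets one estimate serve both directions: from a time in \<T> back to 0, and from 0
  onwards.\<close>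

lemma characteristic_growth:
  fixes v :: "real \<Rightarrow> real \<Rightarrow> complex"
  assumes cont: "continuous_on ({0..} \<times> {0..T}) (\<lambda>(x, t). v x t)" and \<mu>: "0 < \<mu>"
    and eq: "\<And>x s t. 0 \<le> x \<Longrightarrow> 0 \<le> s \<Longrightarrow> s \<le> t \<Longrightarrow> t \<le> T \<Longrightarrow>
       norm (v x t - v x s) = norm (integral {s..t} (\<lambda>\<tau>. integral {0..x} (\<lambda>\<xi>. v \<xi> \<tau>)))"
    and bound: "\<And>x. 0 \<le> x \<Longrightarrow> norm (v x 0) \<le> C * exp (\<mu> * x)"
    and x: "0 \<le> x" and t: "t \<in> {0..T}"
  shows "norm (v x t) \<le> 2 * C * exp (\<mu> * x + 2 / \<mu> * t)"
proof (rule quadrant_Gronwall[OF _ _ \<mu> _ x t])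
  show "continuous_on ({0..} \<times> {0..T}) (\<lambda>(x, t). norm (v x t))"
    using continuous_on_norm[OF cont] by (simp add: case_prod_unfold)
  fix x t :: real assume x: "0 \<le> x" and t: "t \<in> {0..T}"
  have cont_swap: "continuous_on ({0..t} \<times> cbox 0 x) (\<lambda>(\<tau>, \<xi>). v \<xi> \<tau>)"
    by (rule continuous_on_swap_args) (rule continuous_on_subset[OF cont], use t in auto)
  have cont_swap': "continuous_on ({0..t} \<times> cbox 0 x) (\<lambda>(\<tau>, \<xi>). norm (v \<xi> \<tau>))"
    using continuous_on_norm[OF cont_swap] by (simp add: case_prod_unfold)
  have row: "continuous_on {0..x} (\<lambda>\<xi>. v \<xi> \<tau>)" if "\<tau> \<in> {0..t}" for \<tau>
  proof -
    have "continuous_on {0..x} (\<lambda>x. (\<lambda>(x, t). v x t) (x, \<tau>))"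
      by (rule continuous_on_compose2[OF cont]) (use that t in \<open>auto intro!: continuous_intros\<close>)
    then show ?thesis by simp
  qed
  have "norm (integral {0..t} (\<lambda>\<tau>. integral {0..x} (\<lambda>\<xi>. v \<xi> \<tau>)))
      \<le> integral {0..t} (\<lambda>\<tau>. integral {0..x} (\<lambda>\<xi>. norm (v \<xi> \<tau>)))"
  proof (rule integral_norm_bound_integral)
    show "(\<lambda>\<tau>. integral {0..x} (\<lambda>\<xi>. v \<xi> \<tau>)) integrable_on {0..t}"
      using integral_continuous_on_param[OF cont_swap] by (intro integrable_continuous_real) simp
    show "(\<lambda>\<tau>. integral {0..x} (\<lambda>\<xi>. norm (v \<xi> \<tau>))) integrable_on {0..t}"
      using integral_continuous_on_param[OF cont_swap'] by (intro integrable_continuous_real) simp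
    show "norm (integral {0..x} (\<lambda>\<xi>. v \<xi> \<tau>)) \<le> integral {0..x} (\<lambda>\<xi>. norm (v \<xi> \<tau>))" if "\<tau> \<in> {0..t}" for \<tau>
      by (intro integral_norm_bound_integral integrable_continuous_real continuous_on_norm row that) simp
  qed
  moreover have "norm (v x t) \<le> norm (v x 0) + norm (v x t - v x 0)" by norm
  ultimately show "norm (v x t) \<le> C * exp (\<mu> * x) + integral {0..t} (\<lambda>\<tau>. integral {0..x} (\<lambda>\<xi>. norm (v \<xi> \<tau>)))"
    using bound[OF x] eq[of x 0 t] x t by simp
qed simp

text \<open>Integrating by parts in \<open>x\<close>, the transform truncated at \<open>X\<close> satisfies \<open>G' = (G - exp (- p X) J) / p\<close> in \<open>t\<close>,
  where the boundary term with \<open>J\<close> vanishes as \<open>X\<close> tends to infinity.\<close>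

lemma laplace_transport:
  fixes v :: "real \<Rightarrow> real \<Rightarrow> complex"
  assumes cont: "continuous_on ({0..} \<times> {0..T}) (\<lambda>(x, t). v x t)" and "0 \<le> T"
    and eq: "\<And>x t. 0 \<le> x \<Longrightarrow> t \<in> {0..T} \<Longrightarrow>
       v x t - v x 0 = integral {0..x} (\<lambda>\<xi>. integral {0..t} (\<lambda>\<tau>. v \<xi> \<tau>))"
    and bound: "\<And>x t. 0 \<le> x \<Longrightarrow> t \<in> {0..T} \<Longrightarrow> norm (v x t) \<le> C * exp (\<mu> * x)"
    and \<mu>: "0 < \<mu>" "\<mu> < Re p"
  shows "laplace (\<lambda>x. v x 0) p = exp (- of_real T / p) * laplace (\<lambda>x. v x T) p"
proof -
  have p: "p \<noteq> 0" "0 < Re p" using \<mu> by auto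
  have "C \<ge> 0" using bound[of 0 0] \<open>0 \<le> T\<close> norm_ge_zero[of "v 0 0"] by (simp del: norm_ge_zero)
  define e where "e x = exp (- p * complex_of_real x)" for x
  have conte: "continuous_on S e" for S unfolding e_def by (intro continuous_intros)
  have e': "(e has_vector_derivative - p * e x) (at x within S)" for x S
    unfolding e_def by (auto intro!: derivative_eq_intros has_vector_derivative_real_field)
  define G where "G X t = integral {0..X} (\<lambda>x. e x * v x t)" for X t
  define J where "J X t = integral {0..X} (\<lambda>x. v x t)" for X t
  have row: "continuous_on S (\<lambda>x. v x t)" if "t \<in> {0..T}" "S \<subseteq> {0..}" for S t
  proof -
    have "continuous_on S (\<lambda>x. (\<lambda>(x, t). v x t) (x, t))"
      by (rule continuous_on_compose2[OF cont]) (use that in \<open>auto intro!: continuous_intros\<close>)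
    then show ?thesis by simp
  qed
  have cont_swap: "continuous_on (U \<times> V) (\<lambda>(\<tau>, \<xi>). v \<xi> \<tau>)" if "U \<subseteq> {0..T}" "V \<subseteq> {0..}" for U V
    by (rule continuous_on_swap_args) (rule continuous_on_subset[OF cont], use that in auto)
  have cont_swap': "continuous_on (U \<times> V) (\<lambda>(\<tau>, \<xi>). e \<xi> * v \<xi> \<tau>)" if "U \<subseteq> {0..T}" "V \<subseteq> {0..}" for U V
    using cont_swap[OF that] unfolding case_prod_unfold
    by (intro continuous_on_mult continuous_on_compose2[OF conte[of UNIV]] continuous_intros) auto
  have contG: "continuous_on {0..T} (G X)" for X
    unfolding G_def using integral_continuous_on_param[OF cont_swap'[of "{0..T}" "cbox 0 X"]] by simp
  have contJ: "continuous_on {0..T} (J X)" for X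
    unfolding J_def using integral_continuous_on_param[OF cont_swap[of "{0..T}" "cbox 0 X"]] by simp
  have G_eq: "G X t = G X 0 + integral {0..t} (\<lambda>\<tau>. (G X \<tau> - e X * J X \<tau>) / p)"
    if X: "0 \<le> X" and t: "t \<in> {0..T}" for X t
  proof -
    define N where "N x = integral {0..t} (\<lambda>\<tau>. v x \<tau>)" for x
    define P where "P x = integral {0..x} N" for x
    have contN: "continuous_on {0..X} N"
    proof -
      have "continuous_on ({0..X} \<times> cbox 0 t) (\<lambda>(x, t). v x t)"
        by (rule continuous_on_subset[OF cont]) (use t in auto)
      from integral_continuous_on_param[OF this] show ?thesis by (simp add: N_def[abs_def])
    qed
    have P': "(P has_vector_derivative N x) (at x within {0..X})" if "x \<in> {0..X}" for x
      unfolding P_def by (rule integral_has_vector_derivative[OF contN that])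
    have contP: "continuous_on {0..X} P"
      unfolding continuous_on_eq_continuous_within using P' has_vector_derivative_continuous by blast
    \<comment> \<open>The integrand is the derivative of the product of \<open>e\<close> and
      \<open>P\<close>; the value at \<open>X\<close> is the boundary term, that at 0
      vanishes.\<close>
    have "((\<lambda>x. e x * N x + - p * e x * P x) has_integral e X * P X - e 0 * P 0) {0..X}"
      using X by (intro fundamental_theorem_of_calculus has_vector_derivative_mult P' e') auto
    moreover have "P 0 = 0" by (simp add: P_def)
    ultimately have 1: "integral {0..X} (\<lambda>x. e x * N x + - p * e x * P x) = e X * P X"
      by (simp add: integral_unique)
    have iN: "(\<lambda>x. e x * N x) integrable_on {0..X}" and iP: "(\<lambda>x. e x * P x) integrable_on {0..X}"
      by (intro integrable_continuous_real continuous_on_mult conte contN contP)+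
    have iPp: "(\<lambda>x. - p * (e x * P x)) integrable_on {0..X}"
      using iP by (rule integrable_on_mult_right)
    have f1: "integral {0..X} (\<lambda>x. e x * N x) - p * integral {0..X} (\<lambda>x. e x * P x) = e X * P X"
      using 1 integral_add[OF iN iPp] by (simp add: mult.assoc)
    have f2: "integral {0..X} (\<lambda>x. e x * P x) = G X t - G X 0"
    proof -
      have "integral {0..X} (\<lambda>x. e x * P x) = integral {0..X} (\<lambda>x. e x * v x t - e x * v x 0)"
        using eq[OF _ t] by (intro integral_cong) (auto simp: P_def N_def[abs_def] simp flip: right_diff_distrib)
      also have "\<dots> = G X t - G X 0"
        unfolding G_def using t \<open>0 \<le> T\<close>
        by (intro integral_diff integrable_continuous_real continuous_on_mult conte row) auto
      finally show ?thesis .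
    qed
    have f3: "integral {0..X} (\<lambda>x. e x * N x) = integral {0..t} (G X)"
      using integral_swap_continuous[of 0 0 t X "\<lambda>\<tau> \<xi>. e \<xi> * v \<xi> \<tau>"] cont_swap'[of "{0..t}" "{0..X}"] t
      by (simp add: N_def G_def[abs_def] cbox_Pair_eq)
    have f4: "P X = integral {0..t} (J X)"
      using integral_swap_continuous[of 0 0 t X "\<lambda>\<tau> \<xi>. v \<xi> \<tau>"] cont_swap[of "{0..t}" "{0..X}"] t
      by (simp add: P_def N_def[abs_def] J_def[abs_def] cbox_Pair_eq)
    have f5: "integral {0..t} (\<lambda>\<tau>. (G X \<tau> - e X * J X \<tau>) / p) =
        (integral {0..t} (G X) - e X * integral {0..t} (J X)) / p"
    proof -
      have "G X integrable_on {0..t}" "(\<lambda>\<tau>. e X * J X \<tau>) integrable_on {0..t}"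
        using t by (auto intro!: integrable_continuous_real continuous_intros
            continuous_on_subset[OF contG] continuous_on_subset[OF contJ])
      from integral_diff[OF this] show ?thesis by simp
    qed
    have "integral {0..t} (\<lambda>\<tau>. (G X \<tau> - e X * J X \<tau>) / p) = G X t - G X 0"
      unfolding f5 f3[symmetric] f4[symmetric] f1[symmetric] using p by (simp add: f2)
    then show ?thesis by simp
  qed
  have G': "(G X has_vector_derivative (G X t - e X * J X t) / p) (at t within {0..T})"
    if X: "0 \<le> X" and t: "t \<in> {0..T}" for X t
  proof -
    have "((\<lambda>t. G X 0 + integral {0..t} (\<lambda>\<tau>. (G X \<tau> - e X * J X \<tau>) / p)) has_vector_derivative
        0 + (G X t - e X * J X t) / p) (at t within {0..T})"
      by (intro has_vector_derivative_add has_vector_derivative_const integral_has_vector_derivative t)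
        (intro continuous_intros contG contJ ballI p)
    then have "((\<lambda>t. G X 0 + integral {0..t} (\<lambda>\<tau>. (G X \<tau> - e X * J X \<tau>) / p)) has_vector_derivative
        (G X t - e X * J X t) / p) (at t within {0..T})" by simp
    then show ?thesis
      by (rule has_vector_derivative_transform[OF t, rotated]) (rule G_eq[OF X])
  qed
  \<comment> \<open>The integrating factor: in the derivative of \<open>E\<close> times
    \<open>G X\<close> the two terms with \<open>G X\<close> cancel and only the boundary term with
    \<open>J\<close> remains.\<close>
  define E where "E t = exp (- complex_of_real t / p)" for t
  have E': "(E has_vector_derivative - E t / p) (at t within S)" for t S
    unfolding E_def using p by (auto intro!: derivative_eq_intros has_vector_derivative_real_field)
  have nE: "norm (E t) \<le> 1" if "0 \<le> t" for t
    using p that by (simp add: E_def Re_divide divide_nonneg_nonneg)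
  have nJ: "norm (J X t) \<le> C * exp (\<mu> * X) / \<mu>" if X: "0 \<le> X" and t: "t \<in> {0..T}" for X t
  proof -
    have I: "((\<lambda>x. C * exp (\<mu> * x)) has_integral C * ((exp (\<mu> * X) - 1) / \<mu>)) {0..X}"
      by (intro has_integral_mult_right has_integral_exp_0 \<mu> X)
    have "norm (J X t) \<le> integral {0..X} (\<lambda>x. C * exp (\<mu> * x))"
      unfolding J_def using bound t
      by (intro integral_norm_bound_integral integrable_continuous_real row has_integral_integrable[OF I]) auto
    also have "\<dots> = C * ((exp (\<mu> * X) - 1) / \<mu>)" by (rule integral_unique[OF I])
    also have "\<dots> \<le> C * (exp (\<mu> * X) / \<mu>)"
      using \<open>C \<ge> 0\<close> \<mu> by (intro mult_left_mono divide_right_mono) auto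
    finally show ?thesis by simp
  qed
  have diff: "norm (E T * G X T - G X 0) \<le> C / (\<mu> * norm p) * exp (- (Re p - \<mu>) * X) * T" if X: "0 \<le> X" for X
  proof -
    have "((\<lambda>t. E t * ((G X t - e X * J X t) / p) + - E t / p * G X t) has_integral E T * G X T - E 0 * G X 0) {0..T}"
      using \<open>0 \<le> T\<close> by (intro fundamental_theorem_of_calculus has_vector_derivative_mult G' E' X) auto
    moreover have "E 0 = 1" by (simp add: E_def)
    moreover have "E t * ((G X t - e X * J X t) / p) + - E t / p * G X t = - (E t * e X * J X t / p)" for t
      using p by (simp add: field_simps)
    ultimately have I: "((\<lambda>t. - (E t * e X * J X t / p)) has_integral E T * G X T - G X 0) {0..T}"
      by simp
    define B where "B = C / (\<mu> * norm p) * exp (- (Re p - \<mu>) * X)"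
    have "norm (E T * G X T - G X 0) \<le> B * measure lborel (cbox 0 T)"
    proof (rule has_integral_bound[of B "\<lambda>t. - (E t * e X * J X t / p)"])
      show "0 \<le> B" using \<open>C \<ge> 0\<close> \<mu> by (simp add: B_def)
      show "((\<lambda>t. - (E t * e X * J X t / p)) has_integral E T * G X T - G X 0) (cbox 0 T)"
        using I by simp
      fix t assume t: "t \<in> cbox 0 T"
      have "norm (E t) * norm (e X) * norm (J X t) \<le> 1 * exp (- Re p * X) * (C * exp (\<mu> * X) / \<mu>)"
        using nE[of t] nJ[OF X, of t] t \<open>C \<ge> 0\<close> \<mu>
        by (intro mult_mono) (auto simp: e_def)
      also have "\<dots> = C / \<mu> * exp (- (Re p - \<mu>) * X)"
        by (simp add: algebra_simps flip: exp_add)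
      finally have "norm (E t) * norm (e X) * norm (J X t) / norm p \<le> C / \<mu> * exp (- (Re p - \<mu>) * X) / norm p"
        by (rule divide_right_mono) simp
      then show "norm (- (E t * e X * J X t / p)) \<le> B"
        by (simp add: norm_mult norm_divide B_def)
    qed
    then show ?thesis using \<open>0 \<le> T\<close> by (simp add: B_def)
  qed
  have "((\<lambda>X. C / (\<mu> * norm p) * exp (- (Re p - \<mu>) * X) * T) \<longlongrightarrow> 0) at_top"
    using \<mu> by real_asymp
  then have "((\<lambda>X. E T * G X T - G X 0) \<longlongrightarrow> 0) at_top"
    by (rule Lim_null_comparison[rotated]) (use diff in \<open>auto intro!: eventually_at_top_linorderI[of 0]\<close>)
  moreover have lim: "((\<lambda>X. G X t) \<longlongrightarrow> laplace (\<lambda>x. v x t) p) at_top" if t: "t \<in> {0..T}" for t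
    unfolding G_def e_def by (rule laplace_tendsto[OF row[OF t] bound[OF _ t] \<mu>(2)]) auto
  have "((\<lambda>X. E T * G X T - G X 0) \<longlongrightarrow> E T * laplace (\<lambda>x. v x T) p - laplace (\<lambda>x. v x 0) p) at_top"
    using \<open>0 \<le> T\<close> by (intro tendsto_intros lim) auto
  ultimately have "E T * laplace (\<lambda>x. v x T) p - laplace (\<lambda>x. v x 0) p = 0"
    using tendsto_unique trivial_limit_at_top_linorder by blast
  then show ?thesis by (simp add: E_def)
qed

lemma characteristic_uniqueness:
  fixes v :: "real \<Rightarrow> real \<Rightarrow> complex" and \<theta> q :: real
  assumes cont: "continuous_on ({0..} \<times> {0..}) (\<lambda>(x, t). v x t)"
    and eq: "\<And>x s t. 0 \<le> x \<Longrightarrow> 0 \<le> s \<Longrightarrow> s \<le> t \<Longrightarrow>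
       v x t - v x s = integral {0..x} (\<lambda>\<xi>. integral {s..t} (\<lambda>\<tau>. v \<xi> \<tau>))"
    and unbounded: "\<And>M. \<exists>T\<in>\<T>. M < T" and nonneg: "\<And>T. T \<in> \<T> \<Longrightarrow> 0 \<le> T"
    and growth: "\<And>T. T \<in> \<T> \<Longrightarrow> \<exists>C. \<forall>x\<ge>0. norm (v x T) \<le> C * exp (\<theta> * x powr q)"
    and \<theta>: "0 < \<theta>" and q: "0 < q" "q < 1/2" and x: "0 \<le> x" and t: "0 \<le> t"
  shows "v x t = 0"
proof -
  define a where "a = q / (1 - q)"
  have a: "0 < a" "a < 1" using q by (auto simp: a_def)
  have swap: "integral {0..x} (\<lambda>\<xi>. integral {s..t} (\<lambda>\<tau>. v \<xi> \<tau>)) =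
      integral {s..t} (\<lambda>\<tau>. integral {0..x} (\<lambda>\<xi>. v \<xi> \<tau>))" if "0 \<le> s" for x s t
  proof -
    have "continuous_on (cbox (0, s) (x, t)) (\<lambda>(x, t). v x t)"
      unfolding cbox_Pair_eq by (rule continuous_on_subset[OF cont]) (use that in auto)
    from integral_swap_continuous[OF this] show ?thesis by simp
  qed
  have row: "continuous_on {0..} (\<lambda>x. v x t)" if "0 \<le> t" for t
  proof -
    have "continuous_on {0..} (\<lambda>x. (\<lambda>(x, t). v x t) (x, t))"
      by (rule continuous_on_compose2[OF cont]) (use that in \<open>auto intro!: continuous_intros\<close>)
    then show ?thesis by simp
  qed
  have strip: "\<exists>C. \<forall>x\<ge>0. \<forall>t\<in>{0..T}. norm (v x t) \<le> C * exp (\<mu> * x)" if T: "T \<in> \<T>" and \<mu>: "0 < \<mu>" for T \<mu>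
  proof -
    obtain C where C: "\<And>x. 0 \<le> x \<Longrightarrow> norm (v x T) \<le> C * exp (\<theta> * x powr q)"
      using growth[OF T] by blast
    have "C \<ge> 0" using C[of 0] norm_ge_zero[of "v 0 T"] q by (simp del: norm_ge_zero)
    \<comment> \<open>The linear bound on \<open>\<theta> x^q\<close> is taken with
      \<open>\<sigma> = 2 \<mu>\<close>, so that its linear part is \<open>\<mu> x\<close>.\<close>
    define K where "K = C * exp (\<theta> * (2 * \<theta>) powr a * (2 * \<mu>) powr (- a))"
    have "K \<ge> 0" using \<open>C \<ge> 0\<close> by (simp add: K_def)
    have K: "norm (v x T) \<le> K * exp (\<mu> * x)" if x: "0 \<le> x" for x
    proof -
      have "exp (\<theta> * x powr q) \<le> exp (\<mu> * x + \<theta> * (2 * \<theta>) powr a * (2 * \<mu>) powr (- a))"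
        using powr_le_linear[of \<theta> q "2 * \<mu>" x] \<theta> q \<mu> x by (simp add: a_def)
      then have "C * exp (\<theta> * x powr q) \<le> C * exp (\<mu> * x + \<theta> * (2 * \<theta>) powr a * (2 * \<mu>) powr (- a))"
        using \<open>C \<ge> 0\<close> by (rule mult_left_mono)
      with C[OF x] show ?thesis by (simp add: K_def exp_add mult_ac)
    qed
    have "norm (v x t) \<le> (2 * K * exp (2 / \<mu> * T)) * exp (\<mu> * x)" if x: "0 \<le> x" and t: "t \<in> {0..T}" for x t
    proof -
      \<comment> \<open>The growth estimate is applied to the time-reversed function, starting at
        time \<open>T\<close>, and evaluated after a lapse of \<open>T - t\<close>.\<close>
      have "norm (v x (T - (T - t))) \<le> 2 * K * exp (\<mu> * x + 2 / \<mu> * (T - t))"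
      proof (rule characteristic_growth[of T "\<lambda>x t. v x (T - t)", OF _ \<mu> _ _ x])
        have "continuous_on ({0..} \<times> {0..T}) (\<lambda>z. (\<lambda>(x, t). v x t) (fst z, T - snd z))"
          by (rule continuous_on_compose2[OF cont]) (auto intro!: continuous_intros)
        then show "continuous_on ({0..} \<times> {0..T}) (\<lambda>(x, t). v x (T - t))"
          by (simp add: case_prod_unfold)
        show "norm (v x (T - t) - v x (T - s)) =
            norm (integral {s..t} (\<lambda>\<tau>. integral {0..x} (\<lambda>\<xi>. v \<xi> (T - \<tau>))))"
          if "0 \<le> x" "0 \<le> s" "s \<le> t" "t \<le> T" for x s t
        proof -
          have "v x (T - s) - v x (T - t) = integral {T - t..T - s} (\<lambda>\<tau>. integral {0..x} (\<lambda>\<xi>. v \<xi> \<tau>))"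
            using eq[of x "T - t" "T - s"] swap[of "T - t" x "T - s"] that by simp
          also have "\<dots> = integral {s..t} (\<lambda>\<tau>. integral {0..x} (\<lambda>\<xi>. v \<xi> (T - \<tau>)))"
            by (rule integral_reflect_Icc)
          finally show ?thesis by (simp only: norm_minus_commute)
        qed
        show "norm (v x (T - 0)) \<le> K * exp (\<mu> * x)" if "0 \<le> x" for x
          using K[OF that] by simp
      qed (use t in auto)
      also have "\<dots> \<le> 2 * K * exp (\<mu> * x + 2 / \<mu> * T)"
        using \<open>K \<ge> 0\<close> t \<mu> by (intro mult_left_mono) (auto simp: divide_right_mono)
      finally show ?thesis by (simp add: exp_add mult_ac)
    qed
    then show ?thesis by blast
  qed
  obtain T0 where T0: "T0 \<in> \<T>" using unbounded by blast
  have bound0: "\<exists>C. \<forall>x\<ge>0. norm (v x 0) \<le> C * exp (\<mu> * x)" if "0 < \<mu>" for \<mu>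
    using strip[OF T0 that] nonneg[OF T0] by fastforce
  define F where "F = laplace (\<lambda>x. v x 0)"
  define c where "c = \<theta> * (2 * \<theta>) powr a + 1 / a"
  have F0: "F p = 0" if p: "0 < Re p" for p
  proof (rule half_plane_uniqueness[OF _ a _ unbounded nonneg _ p])
    show "F holomorphic_on {p. 0 < Re p}"
      unfolding F_def by (rule holomorphic_on_laplace[OF row bound0]) auto
    show "0 \<le> c" using \<theta> a by (simp add: c_def)
    fix T assume T: "T \<in> \<T>"
    obtain C where C: "\<And>x. 0 \<le> x \<Longrightarrow> norm (v x T) \<le> C * exp (\<theta> * x powr q)"
      using growth[OF T] by blast
    show "\<exists>C. \<forall>p. 0 < Re p \<longrightarrow> norm (F p) \<le> C * exp (- T * Re (1 / p) + c * Re p powr - a)"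
    proof (intro exI allI impI)
      fix p assume p: "0 < Re p"
      \<comment> \<open>This constant depends on \<open>p\<close> as well as \<open>T\<close>. It
        only justifies the transport identity; the final bound contains \<open>C\<close>, which is
        independent of \<open>p\<close>.\<close>
      obtain C' where C': "\<And>x t. 0 \<le> x \<Longrightarrow> t \<in> {0..T} \<Longrightarrow> norm (v x t) \<le> C' * exp (Re p / 2 * x)"
        using strip[OF T half_gt_zero[OF p]] by blast
      have "F p = exp (- of_real T / p) * laplace (\<lambda>x. v x T) p"
        unfolding F_def
        by (rule laplace_transport[OF _ nonneg[OF T] _ C'])
          (use p eq in \<open>auto intro: continuous_on_subset[OF cont]\<close>)
      moreover have "norm (laplace (\<lambda>x. v x T) p) \<le> 2 * C * exp (c * Re p powr (- a))"
        unfolding c_def a_def using q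
        by (intro norm_laplace_le_exp_powr[OF \<theta> _ _ row[OF nonneg[OF T]] C p]) auto
      moreover have "norm (exp (- of_real T / p)) = exp (- T * Re (1 / p))"
        by (simp add: Re_divide)
      ultimately have "norm (F p) \<le> exp (- T * Re (1 / p)) * (2 * C * exp (c * Re p powr (- a)))"
        by (simp add: norm_mult mult_left_mono)
      then show "norm (F p) \<le> 2 * C * exp (- T * Re (1 / p) + c * Re p powr - a)"
        unfolding exp_add by (simp only: mult_ac)
    qed
  qed
  have v0: "v x 0 = 0" if x: "0 \<le> x" for x
  proof -
    obtain C where C: "\<And>x. 0 \<le> x \<Longrightarrow> norm (v x 0) \<le> C * exp (1 * x)"
      using bound0[of 1] by auto
    show ?thesis
      by (rule laplace_zero_imp_zero[of "\<lambda>x. v x 0", OF row C _ x]) (use F0 in \<open>auto simp: F_def\<close>)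
  qed
  \<comment> \<open>Forward from time 0 the data vanish, so the growth estimate holds with constant
    0, here at rate 1.\<close>
  have "norm (v x t) \<le> 2 * 0 * exp (1 * x + 2 / 1 * t)"
    by (rule characteristic_growth[of t v, OF _ _ _ _ x])
      (use eq swap v0 t in \<open>auto intro: continuous_on_subset[OF cont]\<close>)
  then show ?thesis by simp
qed

theorem theorem1p17:
  fixes u :: "real \<times> real \<Rightarrow> complex"
    and Y :: "real set"
    and q \<theta> :: real
  assumes "continuous_on ({0..} \<times> {..0}) u"
    and "Klein_Gordon_distr ({0<..} \<times> {..<0}) u"
    and "\<forall>y\<le>0. u (0, y) = 0"
    and "Y \<noteq> {}" and "Y \<subseteq> {..0}" and "Inf (ereal ` Y) = -\<infinity>"
    and "0 < q" and "q < 1/2" and "0 < \<theta>"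
    and "\<forall>y\<in>Y. (\<lambda>x. norm (u (x, y))) \<in> O[at_top](\<lambda>x. exp (\<theta> * x powr q))"
  shows "\<forall>x\<ge>0. \<forall>y\<le>0. u (x, y) = 0"
proof -
  define v where "v x t = u (x, - t)" for x t
  define \<T> where "\<T> = uminus ` Y"
  have cont: "continuous_on ({0..} \<times> {0..}) (\<lambda>(x, t). v x t)"
    unfolding v_def case_prod_unfold
    by (rule continuous_on_compose2[OF assms(1)]) (auto intro!: continuous_intros)
  have eq: "v x t - v x s = integral {0..x} (\<lambda>\<xi>. integral {s..t} (\<lambda>\<tau>. v \<xi> \<tau>))"
    if x: "0 \<le> x" and st: "0 \<le> s" "s \<le> t" for x s t
  proof (cases "t = 0")
    case True
    then show ?thesis using st by simp
  next
    case False
    \<comment> \<open>The rectangle is \<open>[0, x + 1]\<close> by \<open>[- t, 0]\<close>; the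
      \<open>x + 1\<close> and the exclusion of \<open>t = 0\<close> keep it nondegenerate.\<close>
    have "u (x, - s) - u (x, - t) = u (0, - s) - u (0, - t) -
        integral {0..x} (\<lambda>\<xi>. integral {- t..- s} (\<lambda>y. u (\<xi>, y)))"
      by (rule Klein_Gordon_distr_imp_integral_equation[of 0 "x + 1" "- t" 0, OF _ _ assms(2)])
        (use x st False in \<open>auto intro: continuous_on_subset[OF assms(1)]\<close>)
    moreover have "integral {- t..- s} (\<lambda>y. u (\<xi>, y)) = integral {s..t} (\<lambda>\<tau>. v \<xi> \<tau>)" for \<xi>
      using integral_reflect_Icc[of 0 t s "\<lambda>y. u (\<xi>, y)"] by (simp add: v_def)
    ultimately show ?thesis
      using assms(3) st by (simp add: v_def algebra_simps)
  qed
  have unbounded: "\<exists>T\<in>\<T>. M < T" for M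
  proof -
    have "Inf (ereal ` Y) < ereal (- M)" by (simp add: assms(6))
    then obtain y where "y \<in> Y" "y < - M" by (auto simp: Inf_less_iff)
    then show ?thesis by (auto simp: \<T>_def intro!: bexI[of _ y])
  qed
  have nonneg: "0 \<le> T" if "T \<in> \<T>" for T
    using that assms(5) by (auto simp: \<T>_def)
  have growth: "\<exists>C. \<forall>x\<ge>0. norm (v x T) \<le> C * exp (\<theta> * x powr q)" if T: "T \<in> \<T>" for T
  proof -
    have "(\<lambda>x. norm (v x T)) \<in> O[at_top](\<lambda>x. exp (\<theta> * x powr q))"
      using T assms(10) by (auto simp: \<T>_def v_def)
    then obtain c where "\<forall>\<^sub>F x in at_top. norm (v x T) \<le> c * exp (\<theta> * x powr q)"
      by (auto elim!: landau_o.bigE)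
    then obtain x0 where x0: "\<And>x. x0 \<le> x \<Longrightarrow> norm (v x T) \<le> c * exp (\<theta> * x powr q)"
      by (auto simp: eventually_at_top_linorder)
    \<comment> \<open>The growth bound holds only from \<open>x0\<close> on. On the compact rest a
      bound on \<open>v\<close> suffices, since the weight is at least 1.\<close>
    have "continuous_on {0..x0} (\<lambda>x. (\<lambda>(x, t). v x t) (x, T))"
      by (rule continuous_on_compose2[OF cont]) (use nonneg[OF T] in \<open>auto intro!: continuous_intros\<close>)
    then have "bounded ((\<lambda>x. v x T) ` {0..x0})"
      by (intro compact_imp_bounded compact_continuous_image) auto
    then obtain B where "\<forall>z\<in>(\<lambda>x. v x T) ` {0..x0}. norm z \<le> B"
      unfolding bounded_iff by blast
    then have B: "norm (v x T) \<le> B" if "x \<in> {0..x0}" for x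
      using that by blast
    have "norm (v x T) \<le> max c \<bar>B\<bar> * exp (\<theta> * x powr q)" if x: "0 \<le> x" for x
    proof (cases "x0 \<le> x")
      case True
      have "c * exp (\<theta> * x powr q) \<le> max c \<bar>B\<bar> * exp (\<theta> * x powr q)"
        by (intro mult_right_mono) auto
      with x0[OF True] show ?thesis by (rule order_trans)
    next
      case False
      then have "norm (v x T) \<le> \<bar>B\<bar> * 1" using B[of x] x by simp
      also have "\<dots> \<le> max c \<bar>B\<bar> * exp (\<theta> * x powr q)"
        using assms(9) by (intro mult_mono) auto
      finally show ?thesis .
    qed
    then show ?thesis by blast
  qed
  have zero: "v x t = 0" if "0 \<le> x" "0 \<le> t" for x t
    by (rule characteristic_uniqueness[OF cont eq unbounded nonneg growth assms(9,7,8) that])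
  show ?thesis
  proof (intro allI impI)
    fix x y :: real assume "0 \<le> x" "y \<le> 0"
    then show "u (x, y) = 0" using zero[of x "- y"] by (simp add: v_def)
  qed
qed

end
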